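(* Let $\phi(x)=x^3+7x^2-7\in\mathbb{Z}[x]$. Then $G_{\mathbb{Q}}(\phi)$ is a subgroup of index $2$ in $\mathrm{Aut}(T_\infty)$.
   Context: $T_\infty$ is the pre-image tree of $0$ under $\phi$: vertices $\bigsqcup_{n\ge0}\phi^{-n}(0)$ (with $\phi^{-0}(0)=\{0\}$), and $\beta\in\phi^{-(n+1)}(0)$ is joined to $\phi(\beta)\in\phi^{-n}(0)$. $\mathrm{Aut}(T_\infty)$ is its graph automorphism group, and $G_{\mathbb{Q}}(\phi)$ is the image of the natural homomorphism $\mathrm{Gal}(\overline{\mathbb{Q}}/\mathbb{Q})\to\mathrm{Aut}(T_\infty)$ induced by the Galois action on the sets $\phi^{-n}(0)$. *)

theory Defs
  imports "HOL-Computational_Algebra.Polynomial" "HOL-Algebra.Bij" "HOL-Algebra.Coset"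
begin

definition phi :: "complex \<Rightarrow> complex" where
  "phi x = x ^ 3 + 7 * x ^ 2 - 7"

text \<open>Vertices of the pre-image tree: disjoint union of the sets phi^{-n}(0),
  tagged by the level n.\<close>
definition tree_verts :: "(nat \<times> complex) set" where
  "tree_verts = {(n, z). (phi ^^ n) z = 0}"

definition tree_adj :: "nat \<times> complex \<Rightarrow> nat \<times> complex \<Rightarrow> bool" where
  "tree_adj u v \<longleftrightarrow> u \<in> tree_verts \<and> v \<in> tree_verts \<and>
     ((fst u = Suc (fst v) \<and> phi (snd u) = snd v) \<or>
      (fst v = Suc (fst u) \<and> phi (snd v) = snd u))"

definition tree_aut :: "(nat \<times> complex \<Rightarrow> nat \<times> complex) set" where
  "tree_aut = {f \<in> Bij tree_verts.
      \<forall>u\<in>tree_verts. \<forall>v\<in>tree_verts. tree_adj (f u) (f v) \<longleftrightarrow> tree_adj u v}"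

definition AutT :: "(nat \<times> complex \<Rightarrow> nat \<times> complex) monoid" where
  "AutT = (BijGroup tree_verts) \<lparr>carrier := tree_aut\<rparr>"

text \<open>Qbar realised as the algebraic complex numbers; Gal(Qbar/Q) is the set of
  field automorphisms of Qbar (these automatically fix Q).\<close>
definition Qbar :: "complex set" where
  "Qbar = {z. algebraic z}"

definition abs_galois :: "(complex \<Rightarrow> complex) set" where
  "abs_galois = {s. bij_betw s Qbar Qbar \<and> s 1 = 1 \<and>
      (\<forall>x\<in>Qbar. \<forall>y\<in>Qbar. s (x + y) = s x + s y \<and> s (x * y) = s x * s y)}"

definition galois_action :: "(complex \<Rightarrow> complex) \<Rightarrow> (nat \<times> complex \<Rightarrow> nat \<times> complex)" where
  "galois_action s = (\<lambda>v\<in>tree_verts. (fst v, s (snd v)))"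

definition G_Q_phi :: "(nat \<times> complex \<Rightarrow> nat \<times> complex) set" where
  "G_Q_phi = galois_action ` abs_galois"

end

theory Submission
  imports Defs "HOL-Computational_Algebra.Computational_Algebra"
begin

text \<open>
  The discriminant of \<open>phi - \<alpha>\<close> is \<open>(\<alpha> + 7) (1183 - 27 \<alpha>)\<close>. For \<open>\<alpha> = 0\<close> it is \<open>91\<^sup>2\<close>, so Galois acts on the
  first level by even permutations, and the claim is that this is the only constraint.

  Galois is transitive on each level, since all iterates of \<open>phi\<close> are Eisenstein at 7. For \<open>n \<ge> 1\<close> the
  product of the discriminants over level \<open>n\<close> is a positive integer that is not a square (modulo 67), so some
  prime \<open>p\<close> divides it to an odd power. As the critical point 0 is mapped to the fixed point \<open>-7\<close>, this \<open>p\<close> is different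
  from 3 and 7 and unramified in the field of level \<open>n\<close>, and modulo a prime above \<open>p\<close> exactly one pair
  of points of level \<open>n + 1\<close> collides. Inertia at that prime is nontrivial and hence generated by a single
  transposition. By transitivity all transpositions inside the fibres over level \<open>n\<close> are Galois, so every
  tree automorphism that is even on the first level is approximated by Galois elements on each level, and
  the image of Galois is closed.
\<close>

section \<open>Integral and algebraic numbers\<close>

text \<open>The shape of the proof is dictated by ramification. All arithmetic takes place in the
  ring \<open>OQ\<close> of all algebraic integers, where a prime \<open>M\<close> over
  \<open>p\<close> has no uniformiser and no ramification index. Ramification in the field of level
  \<open>n + 1\<close> is witnessed by a single element instead: a square root of the product of the
  discriminants, divided by a power of \<open>p\<close>, is an \<open>r\<close> with
  \<open>r^2 = p u\<close> and \<open>u\<close> prime to \<open>p\<close>; this is where the odd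
  exponent enters. \<open>ramified_imp_inertia\<close> turns such an \<open>r\<close> into an
  automorphism that is trivial modulo \<open>M\<close> but moves a vertex. The prime depends on
  \<open>n\<close> and is never computed: the residue modulo 67 only shows that it exists. It has to
  be new at each level, since inertia must fix level \<open>n\<close> pointwise;
  \<open>crit_levels_disjoint\<close> guarantees this. The facts about the infinite Galois group
  rest on \<open>hom_graph_extends\<close>: that fixed numbers are rational, and that automorphisms
  given level by level glue to one.\<close>

inductive_set lin_span :: "complex set \<Rightarrow> complex set \<Rightarrow> complex set" for A B where
  zero: "0 \<in> lin_span A B"
| base: "b \<in> B \<Longrightarrow> b \<in> lin_span A B"
| add: "x \<in> lin_span A B \<Longrightarrow> y \<in> lin_span A B \<Longrightarrow> x + y \<in> lin_span A B"
| scale: "a \<in> A \<Longrightarrow> x \<in> lin_span A B \<Longrightarrow> a * x \<in> lin_span A B"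

text \<open>With \<open>A = \<int>\<close> this is integrality, with \<open>A = \<rat>\<close> algebraicity. In this form closure under sums and
  products needs no determinants or resultants.\<close>

definition fin_pow :: "complex set \<Rightarrow> complex \<Rightarrow> bool" where
  "fin_pow A x \<longleftrightarrow> (\<exists>B. finite B \<and> (\<forall>k. x ^ k \<in> lin_span A B))"

lemma fin_powI: "finite B \<Longrightarrow> (\<And>k. x ^ k \<in> lin_span A B) \<Longrightarrow> fin_pow A x"
  unfolding fin_pow_def by blast

lemma lin_span_mult:
  assumes "x \<in> lin_span A B" "y \<in> lin_span A C"
  shows "x * y \<in> lin_span A ((\<lambda>(b, c). b * c) ` (B \<times> C))"
  using assms(1)
proof induction
  case (base b)
  from assms(2) show ?case
  proof induction
    case (base c)
    then show ?case using \<open>b \<in> B\<close> by (intro lin_span.base) force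
  next
    case (scale a x)
    then show ?case using lin_span.scale[of a A "b * x"] by (simp add: mult.left_commute)
  qed (auto intro: lin_span.intros simp: distrib_left)
qed (auto intro: lin_span.intros simp: distrib_right mult.assoc)

lemma lin_span_sum:
  "(\<And>i. i \<in> I \<Longrightarrow> f i \<in> lin_span A B) \<Longrightarrow> (\<Sum>i\<in>I. f i) \<in> lin_span A B"
  by (induction I rule: infinite_finite_induct) (auto intro: lin_span.intros)

text \<open>The binomial theorem puts every power of \<open>x + y\<close> into the span of the
  finitely many products of generators; \<open>A\<close> has to contain the binomial
  coefficients.\<close>

lemma fin_pow_add:
  assumes "\<int> \<subseteq> A" "fin_pow A x" "fin_pow A y"
  shows "fin_pow A (x + y)"
proof -
  obtain B C where B: "finite B" "\<And>k. x ^ k \<in> lin_span A B"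
    and C: "finite C" "\<And>k. y ^ k \<in> lin_span A C"
    using assms unfolding fin_pow_def by blast
  have "(x + y) ^ k \<in> lin_span A ((\<lambda>(b, c). b * c) ` (B \<times> C))" for k
  proof -
    have "of_nat (k choose i) * (x ^ i * y ^ (k - i)) \<in> lin_span A ((\<lambda>(b, c). b * c) ` (B \<times> C))" for i
      by (intro lin_span.scale lin_span_mult B C subsetD[OF assms(1)] Ints_of_nat)
    then show ?thesis unfolding binomial_ring mult.assoc by (intro lin_span_sum)
  qed
  then show ?thesis by (rule fin_powI[rotated]) (simp add: B(1) C(1))
qed

lemma fin_pow_mult:
  assumes "fin_pow A x" "fin_pow A y"
  shows "fin_pow A (x * y)"
proof -
  obtain B C where B: "finite B" "\<And>k. x ^ k \<in> lin_span A B"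
    and C: "finite C" "\<And>k. y ^ k \<in> lin_span A C"
    using assms unfolding fin_pow_def by blast
  have "(x * y) ^ k \<in> lin_span A ((\<lambda>(b, c). b * c) ` (B \<times> C))" for k
    unfolding power_mult_distrib by (rule lin_span_mult[OF B(2) C(2)])
  then show ?thesis by (rule fin_powI[rotated]) (simp add: B(1) C(1))
qed

text \<open>The powers below the degree generate: their span contains 1 and is stable under
  multiplication by \<open>x\<close>, because the equation rewrites \<open>x ^ n\<close>.\<close>

lemma fin_pow_monic_root:
  assumes p: "\<And>i. coeff p i \<in> A" "lead_coeff p = 1" "poly p x = 0"
    and A: "\<int> \<subseteq> A" "\<And>a b. a \<in> A \<Longrightarrow> b \<in> A \<Longrightarrow> a * b \<in> A"
  shows "fin_pow A x"
proof -
  define n where "n = degree p"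
  define B where "B = (\<lambda>i. x ^ i) ` {..<n}"
  have "0 = (\<Sum>i\<le>n. coeff p i * x ^ i)" using p(3) by (simp add: poly_altdef n_def)
  also have "\<dots> = x ^ n + (\<Sum>i<n. coeff p i * x ^ i)"
    using p(2) by (simp add: n_def lessThan_Suc_atMost[symmetric])
  finally have xn: "x ^ n = (\<Sum>i<n. (- 1 * coeff p i) * x ^ i)"
    by (simp add: sum_negf eq_neg_iff_add_eq_0)
  have "- 1 * coeff p i \<in> A" for i
    by (rule A(2)[OF subsetD[OF A(1)] p(1)]) simp
  then have xn': "x ^ n \<in> lin_span A B"
    unfolding xn B_def by (intro lin_span_sum lin_span.scale lin_span.base) auto
  have step: "x * y \<in> lin_span A B" if "y \<in> lin_span A B" for y
    using that
  proof induction
    case (base b)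
    then obtain i where i: "i < n" "b = x ^ i" by (auto simp: B_def)
    show ?case
    proof (cases "Suc i = n")
      case True
      then show ?thesis using xn' i by auto
    next
      case False
      then show ?thesis using i by (intro lin_span.base) (auto simp: B_def intro!: image_eqI[of _ _ "Suc i"])
    qed
  next
    case (scale a y)
    then show ?case by (metis lin_span.scale mult.left_commute)
  qed (auto intro: lin_span.intros simp: distrib_left)
  have "n > 0" unfolding n_def using p(2,3) by (cases p) (auto split: if_splits)
  then have "1 \<in> lin_span A B" by (intro lin_span.base) (auto simp: B_def intro!: image_eqI[of _ _ 0])
  then have "x ^ k \<in> lin_span A B" for k by (induction k) (auto intro: step)
  then show ?thesis by (rule fin_powI[rotated]) (simp add: B_def)
qed

text \<open>The complex numbers as a rational vector space, for dimension counting and for the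
  extension of rational functionals.\<close>

interpretation rat_vs: vector_space "\<lambda>(q::rat) (z::complex). of_rat q * z"
  by unfold_locales (auto simp: algebra_simps of_rat_add of_rat_mult)

interpretation rat_vs_pair: vector_space_pair "\<lambda>(q::rat) (z::complex). of_rat q * z" "(*) :: rat \<Rightarrow> rat \<Rightarrow> rat"
  by unfold_locales (auto simp: algebra_simps)

lemma lin_span_Rats: "x \<in> lin_span \<rat> B \<Longrightarrow> x \<in> rat_vs.span B"
proof (induction rule: lin_span.induct)
  case (scale a x)
  then obtain q where "a = of_rat q" by (auto elim: Rats_cases)
  then show ?case using scale rat_vs.span_scale by auto
qed (auto intro: rat_vs.span_zero rat_vs.span_base rat_vs.span_add)

text \<open>More powers of \<open>x\<close> than generators are linearly dependent. If two of these
  powers coincide, \<open>S\<close> is too small for this count, but then \<open>x\<close> is a root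
  of a difference of monomials.\<close>

lemma fin_pow_Rats_imp_algebraic:
  assumes "fin_pow \<rat> x"
  shows "algebraic x"
proof -
  obtain B where B: "finite B" "\<And>k. x ^ k \<in> rat_vs.span B"
    using assms lin_span_Rats unfolding fin_pow_def by blast
  define n where "n = card B"
  define S where "S = (\<lambda>k. x ^ k) ` {..n}"
  show ?thesis
  proof (cases "inj_on (\<lambda>k. x ^ k) {..n}")
    case False
    then obtain i j where ij: "i \<noteq> j" "x ^ i = x ^ j" by (auto simp: inj_on_def)
    define p where "p = monom (1::complex) i - monom 1 j"
    have "coeff p i = 1" using ij by (simp add: p_def)
    then have "p \<noteq> 0" by force
    moreover have "poly p x = 0" using ij by (simp add: p_def poly_monom)
    moreover have "coeff p k \<in> \<int>" for k by (auto simp: p_def)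
    ultimately show ?thesis by (intro algebraicI) auto
  next
    case True
    then have "card S = Suc n" by (simp add: S_def card_image)
    then have "rat_vs.dependent S"
      using rat_vs.independent_span_bound[of B S] B unfolding n_def S_def by force
    then obtain u where u: "\<exists>v\<in>S. u v \<noteq> 0" "(\<Sum>v\<in>S. of_rat (u v) * v) = 0"
      using rat_vs.dependent_finite[of S] unfolding S_def by auto
    define p where "p = (\<Sum>k\<le>n. monom (of_rat (u (x ^ k)) :: complex) k)"
    have cp: "coeff p k = (if k \<le> n then of_rat (u (x ^ k)) else 0)" for k
      by (simp add: p_def coeff_sum)
    have "poly p x = (\<Sum>v\<in>S. of_rat (u v) * v)"
      unfolding S_def by (subst sum.reindex[OF True]) (simp add: p_def poly_sum poly_monom)
    then have "poly p x = 0" using u by simp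
    moreover have "p \<noteq> 0"
    proof -
      from u obtain k where "k \<le> n" "u (x ^ k) \<noteq> 0" by (auto simp: S_def)
      then have "coeff p k \<noteq> 0" by (simp add: cp)
      then show ?thesis by force
    qed
    moreover have "coeff p k \<in> \<rat>" for k by (auto simp: cp)
    ultimately show ?thesis unfolding algebraic_altdef by blast
  qed
qed

lemma algebraic_imp_fin_pow:
  assumes "algebraic x"
  shows "fin_pow \<rat> x"
proof -
  obtain p where p: "\<And>i. coeff p i \<in> \<rat>" "p \<noteq> 0" "poly p x = 0"
    using assms unfolding algebraic_altdef by blast
  define q where "q = smult (inverse (lead_coeff p)) p"
  show ?thesis
  proof (rule fin_pow_monic_root)
    show "coeff q i \<in> \<rat>" for i using p(1) by (simp add: q_def)
  qed (use p Ints_subset_Rats in \<open>auto simp: q_def\<close>)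
qed

lemma algebraic_add: "algebraic x \<Longrightarrow> algebraic y \<Longrightarrow> algebraic (x + y :: complex)"
  by (rule fin_pow_Rats_imp_algebraic[OF fin_pow_add[OF Ints_subset_Rats
        algebraic_imp_fin_pow algebraic_imp_fin_pow]])

lemma algebraic_mult: "algebraic x \<Longrightarrow> algebraic y \<Longrightarrow> algebraic (x * y :: complex)"
  by (rule fin_pow_Rats_imp_algebraic[OF fin_pow_mult[OF algebraic_imp_fin_pow algebraic_imp_fin_pow]])

lemma algebraic_int_imp_fin_pow:
  assumes "algebraic_int x"
  shows "fin_pow \<int> x"
  using assms
proof cases
  case (1 p)
  then show ?thesis by (intro fin_pow_monic_root[of p]) auto
qed

text \<open>For a denominator \<open>b\<close> in lowest terms the hypothesis forces
  \<open>b ^ k dvd d\<close> for all \<open>k\<close>.\<close>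

lemma rat_powers_bounded_denom:
  fixes q :: rat and d :: int
  assumes "d > 0" "\<And>k. of_int d * q ^ k \<in> \<int>"
  shows "q \<in> \<int>"
proof -
  obtain a b where ab: "quotient_of q = (a, b)" by force
  then have q: "q = of_int a / of_int b" "b > 0" "coprime a b"
    using quotient_of_div quotient_of_denom_pos quotient_of_coprime by blast+
  have dvd: "b ^ k dvd d" for k
  proof -
    obtain m where "of_int d * q ^ k = of_int m" using assms(2) by (auto elim: Ints_cases)
    then have "of_int (d * a ^ k) = (of_int (m * b ^ k) :: rat)"
      using q by (simp add: power_divide field_simps)
    then have "d * a ^ k = m * b ^ k" by (simp only: of_int_eq_iff)
    then have "b ^ k dvd d * a ^ k" by simp
    moreover have "coprime (b ^ k) (a ^ k)" using q(3) by (simp add: coprime_commute)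
    ultimately show ?thesis by (simp add: coprime_dvd_mult_left_iff)
  qed
  have "b = 1"
  proof (rule ccontr)
    assume "b \<noteq> 1"
    then have b2: "b \<ge> 2" using q by auto
    \<comment> \<open>The exponent \<open>nat d\<close> is large enough, as \<open>2 ^ nat d\<close>
      exceeds \<open>d\<close>.\<close>
    have "b ^ nat d \<le> d" using dvd[of "nat d"] assms(1) zdvd_imp_le by blast
    moreover have "int (nat d) < 2 ^ nat d" by (metis of_nat_less_two_power)
    moreover have "(2::int) ^ nat d \<le> b ^ nat d" using b2 by (intro power_mono) auto
    ultimately show False using assms(1) by linarith
  qed
  then show ?thesis using q by simp
qed

text \<open>The generators may be irrational, so denominators can be bounded only after a projection
  to the rationals. This is the integral closedness of \<int>.\<close>

lemma fin_pow_Ints_rational: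
  assumes "fin_pow \<int> x" "x \<in> \<rat>"
  shows "x \<in> \<int>"
proof -
  obtain q where q: "x = of_rat q" using assms(2) by (auto elim: Rats_cases)
  obtain B where B: "finite B" "\<And>k. x ^ k \<in> lin_span \<int> B"
    using assms(1) unfolding fin_pow_def by blast
  \<comment> \<open>A rational functional fixing 1 maps the module of powers of \<open>x\<close> into a module of rationals with a common denominator.\<close>
  have "rat_vs.independent {1}" by simp
  then obtain g where g: "Vector_Spaces.linear (\<lambda>(q::rat) (z::complex). of_rat q * z) ((*) :: rat \<Rightarrow> rat \<Rightarrow> rat) g" "g 1 = 1"
    using rat_vs_pair.linear_independent_extend[of "{1}" "\<lambda>_. 1"] by auto
  interpret g: Vector_Spaces.linear "\<lambda>(q::rat) (z::complex). of_rat q * z" "(*) :: rat \<Rightarrow> rat \<Rightarrow> rat" g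
    by (rule g(1))
  have gq: "g (of_rat r) = r" for r using g.scale[of r 1] g(2) by simp
  define d where "d = (\<Prod>b\<in>B. snd (quotient_of (g b)))"
  have dpos: "d > 0" unfolding d_def by (intro prod_pos) (auto intro: quotient_of_denom_pos')
  have "of_int d * g z \<in> \<int>" if "z \<in> lin_span \<int> B" for z
    using that
  proof induction
    case (base b)
    obtain m n where mn: "quotient_of (g b) = (m, n)" by force
    have "g b = of_int m / of_int n" "n > 0" using mn quotient_of_div quotient_of_denom_pos by auto
    moreover have "n dvd d" unfolding d_def using dvd_prodI[OF B(1) base, of "\<lambda>b. snd (quotient_of (g b))"] mn by simp
    ultimately show ?case by (auto elim!: dvdE)
  next
    case (scale a x)
    then obtain k where k: "a = of_int k" by (auto elim: Ints_cases)
    have "g (a * x) = of_int k * g x" using g.scale[of "of_int k" x] k by simp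
    moreover have "of_int k * (of_int d * g x) \<in> \<int>" by (rule Ints_mult[OF Ints_of_int scale.IH])
    ultimately show ?case by (metis mult.left_commute)
  qed (auto simp: g.add g.zero distrib_left)
  then have "of_int d * g (x ^ k) \<in> \<int>" for k using B by blast
  then have "of_int d * q ^ k \<in> \<int>" for k using gq[of "q ^ k"] by (metis q of_rat_power)
  then have "q \<in> \<int>" using rat_powers_bounded_denom dpos by blast
  then show ?thesis by (auto simp: q elim!: Ints_cases)
qed

section \<open>Extending field homomorphisms to the algebraic numbers\<close>

text \<open>The graph of a field homomorphism from a subfield of the algebraic numbers into the complex
  numbers. Closure under inverses need not be demanded: the inverse of an algebraic number is a
  rational polynomial in it.\<close>

definition hom_graph :: "(complex \<times> complex) set \<Rightarrow> bool" where
  "hom_graph F \<longleftrightarrow> (\<forall>q\<in>\<rat>. (q, q) \<in> F) \<and>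
     (\<forall>x x' y y'. (x, x') \<in> F \<longrightarrow> (y, y') \<in> F \<longrightarrow> (x + y, x' + y') \<in> F \<and> (x * y, x' * y') \<in> F) \<and>
     (\<forall>y. (0, y) \<in> F \<longrightarrow> y = 0) \<and> (\<forall>x y. (x, y) \<in> F \<longrightarrow> algebraic x)"

text \<open>A relation and not a map, since the homomorphism is partial: it says at once that the
  coefficients of \<open>p\<close> lie in the domain and that \<open>p'\<close> is the image of
  \<open>p\<close>.\<close>

definition poly_rel :: "(complex \<times> complex) set \<Rightarrow> complex poly \<Rightarrow> complex poly \<Rightarrow> bool" where
  "poly_rel F p p' \<longleftrightarrow> (\<forall>i. (coeff p i, coeff p' i) \<in> F)"

text \<open>Factors \<open>X\<close> are stripped from an annihilating polynomial until its constant
  term is nonzero, which is possible as \<open>z\<close> is not 0.\<close>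

lemma algebraic_nonzero_relation:
  assumes "algebraic z" "z \<noteq> (0::complex)"
  shows "\<exists>c q. c \<in> \<rat> \<and> c \<noteq> 0 \<and> (\<forall>i. coeff q i \<in> \<rat>) \<and> poly (pCons c q) z = 0"
proof -
  obtain p where "\<And>i. coeff p i \<in> \<rat>" "p \<noteq> 0" "poly p z = 0"
    using assms(1) unfolding algebraic_altdef by blast
  then show ?thesis
  proof (induction p)
    case (pCons a p)
    have cp: "coeff p i \<in> \<rat>" for i using pCons.prems(1)[of "Suc i"] by simp
    have a: "a \<in> \<rat>" using pCons.prems(1)[of 0] by simp
    show ?case
    proof (cases "a = 0")
      case True
      then show ?thesis using pCons.IH[OF cp] pCons.prems assms(2) by simp
    next
      case False
      then show ?thesis using a cp pCons.prems(3) by blast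
    qed
  qed simp
qed

lemma poly_algebraic:
  assumes "algebraic x" "\<And>i. algebraic (coeff p i)"
  shows "algebraic (poly p x :: complex)"
  using assms(2)
proof (induction p)
  case (pCons a p)
  have "algebraic (coeff p i)" for i using pCons.prems[of "Suc i"] by simp
  moreover have "algebraic a" using pCons.prems[of 0] by simp
  ultimately show ?case using pCons assms(1) by (simp add: algebraic_add algebraic_mult)
qed simp

locale hom_graph_on =
  fixes F
  assumes hg: "hom_graph F"
begin

lemma rat: "q \<in> \<rat> \<Longrightarrow> (q, q) \<in> F"
  and add: "(x, x') \<in> F \<Longrightarrow> (y, y') \<in> F \<Longrightarrow> (x + y, x' + y') \<in> F"
  and mult: "(x, x') \<in> F \<Longrightarrow> (y, y') \<in> F \<Longrightarrow> (x * y, x' * y') \<in> F"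
  and zeroD: "(0, y) \<in> F \<Longrightarrow> y = 0"
  and alg: "(x, y) \<in> F \<Longrightarrow> algebraic x"
  using hg unfolding hom_graph_def by blast+

lemma zero: "(0, 0) \<in> F" and one: "(1, 1) \<in> F"
  by (rule rat, simp)+

lemma diff: "(x, x') \<in> F \<Longrightarrow> (y, y') \<in> F \<Longrightarrow> (x - y, x' - y') \<in> F"
  using add[of x x' "-1 * y" "-1 * y'"] mult[OF rat[of "-1"], of y y'] by simp

lemma single_valued: "(x, y) \<in> F \<Longrightarrow> (x, z) \<in> F \<Longrightarrow> y = z"
  using zeroD[of "y - z"] diff[of x y x z] by simp

lemma poly_rat: "(x, y) \<in> F \<Longrightarrow> (\<And>i. coeff q i \<in> \<rat>) \<Longrightarrow> (poly q x, poly q y) \<in> F"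
proof (induction q)
  case (pCons a q)
  have "coeff q i \<in> \<rat>" for i using pCons.prems(2)[of "Suc i"] by simp
  moreover have "a \<in> \<rat>" using pCons.prems(2)[of 0] by simp
  ultimately show ?case using pCons by (simp add: add mult rat)
qed (simp add: zero)

lemma poly_root: "(x, y) \<in> F \<Longrightarrow> (\<And>i. coeff q i \<in> \<rat>) \<Longrightarrow> poly q x = 0 \<Longrightarrow> poly q y = 0"
  using poly_rat[of x y q] zeroD by simp

text \<open>A relation \<open>c + x q(x) = 0\<close> with rational coefficients passes to
  \<open>y\<close>, so the same expression \<open>- q / c\<close> inverts both.\<close>

lemma inverse:
  assumes "(x, y) \<in> F"
  shows "(inverse x, inverse y) \<in> F"
proof (cases "x = 0")
  case True
  then have "y = 0" using zeroD assms by blast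
  then show ?thesis using True zero by simp
next
  case False
  then obtain c q where cq: "c \<in> \<rat>" "c \<noteq> 0" "\<And>i. coeff q i \<in> \<rat>" "poly (pCons c q) x = 0"
    using algebraic_nonzero_relation alg assms by blast
  have y: "poly (pCons c q) y = 0"
    using cq by (intro poly_root[OF assms]) (auto simp: coeff_pCons split: nat.splits)
  have inv: "inverse z = (- inverse c) * poly q z" if "poly (pCons c q) z = 0" for z
  proof -
    have "z * poly q z = - c" using that by (simp add: eq_neg_iff_add_eq_0 add.commute)
    then have "z * ((- inverse c) * poly q z) = 1"
      using cq(2) by (metis mult.left_commute minus_mult_minus left_inverse)
    then show ?thesis by (rule inverse_unique)
  qed
  have "- inverse c \<in> \<rat>" using cq(1) by simp
  then show ?thesis unfolding inv[OF cq(4)] inv[OF y] using cq(3) assms by (intro mult rat poly_rat)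
qed

lemma inj: "(x, z) \<in> F \<Longrightarrow> (y, z) \<in> F \<Longrightarrow> x = y"
proof (rule ccontr)
  assume a: "(x, z) \<in> F" "(y, z) \<in> F" "x \<noteq> y"
  have "(x - y, 0) \<in> F" using diff[OF a(1,2)] by simp
  from mult[OF inverse[OF this] this] have "(1, 0) \<in> F" using a(3) by simp
  then show False using single_valued one by fastforce
qed

lemma sum: "(\<And>i. i \<in> I \<Longrightarrow> (f i, g i) \<in> F) \<Longrightarrow> (sum f I, sum g I) \<in> F"
  by (induction I rule: infinite_finite_induct) (auto simp: zero add)

lemma poly_rel_mult: "poly_rel F p p' \<Longrightarrow> poly_rel F q q' \<Longrightarrow> poly_rel F (p * q) (p' * q')"
  unfolding poly_rel_def coeff_mult by (auto intro!: sum mult)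

lemma poly_rel_add: "poly_rel F p p' \<Longrightarrow> poly_rel F q q' \<Longrightarrow> poly_rel F (p + q) (p' + q')"
  unfolding poly_rel_def by (auto intro!: add)

lemma poly_rel_diff: "poly_rel F p p' \<Longrightarrow> poly_rel F q q' \<Longrightarrow> poly_rel F (p - q) (p' - q')"
  unfolding poly_rel_def by (auto intro!: diff)

lemma poly_rel_monom: "(c, c') \<in> F \<Longrightarrow> poly_rel F (monom c n) (monom c' n)"
  unfolding poly_rel_def by (auto simp: zero)

lemma poly_rel_0: "poly_rel F 0 p \<Longrightarrow> p = 0"
  unfolding poly_rel_def using zeroD by (intro poly_eqI) simp

text \<open>\<open>m\<close> is the minimal polynomial of \<open>x\<close> over the domain of
  \<open>F\<close>, and \<open>m'\<close> its image. Minimality ranges over the polynomials that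
  have an image, i.e. those with coefficients in that domain.\<close>

definition min_pair :: "complex \<Rightarrow> complex poly \<Rightarrow> complex poly \<Rightarrow> bool" where
  "min_pair x m m' \<longleftrightarrow> poly_rel F m m' \<and> lead_coeff m = 1 \<and> poly m x = 0 \<and>
     (\<forall>p p'. poly_rel F p p' \<longrightarrow> p \<noteq> 0 \<longrightarrow> poly p x = 0 \<longrightarrow> degree m \<le> degree p)"

lemma min_pair_ex:
  assumes "algebraic x"
  shows "\<exists>m m'. min_pair x m m'"
proof -
  define P where "P = (\<lambda>(p, p'). poly_rel F p p' \<and> p \<noteq> 0 \<and> poly p x = 0)"
  obtain q where q: "\<And>i. coeff q i \<in> \<rat>" "q \<noteq> 0" "poly q x = 0"
    using assms unfolding algebraic_altdef by blast
  then have "P (q, q)" by (auto simp: P_def poly_rel_def intro: rat)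
  from ex_has_least_nat[of P, OF this, of "degree \<circ> fst"]
  obtain p p' where p: "P (p, p')" and least: "\<And>r r'. P (r, r') \<Longrightarrow> degree p \<le> degree r"
    by force
  define c where "c = inverse (lead_coeff p)"
  have c: "c \<noteq> 0" using p by (simp add: c_def P_def)
  obtain c' where c': "(c, c') \<in> F"
    using inverse[of "lead_coeff p" "coeff p' (degree p)"] p unfolding c_def P_def poly_rel_def by auto
  have "poly_rel F (smult c p) (smult c' p')"
    using p c' unfolding P_def poly_rel_def by (auto intro: mult)
  moreover have "lead_coeff (smult c p) = 1" using p by (simp add: c_def P_def)
  moreover have "degree (smult c p) = degree p" using c by simp
  ultimately have "min_pair x (smult c p) (smult c' p')"
    using p least unfolding min_pair_def by (auto simp: P_def)
  then show ?thesis by blast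
qed

lemma min_pair_degree:
  assumes "min_pair x m m'"
  shows "degree m > 0" "degree m' = degree m" "lead_coeff m' = 1"
proof -
  have m: "poly_rel F m m'" "lead_coeff m = 1" "poly m x = 0" using assms by (auto simp: min_pair_def)
  show "degree m > 0" using m(2,3) by (cases m) (auto split: if_splits)
  have "(1, coeff m' (degree m)) \<in> F" using m unfolding poly_rel_def by metis
  then have 1: "coeff m' (degree m) = 1" using single_valued one by blast
  have "coeff m' i = 0" if "i > degree m" for i
    using m(1) that zeroD unfolding poly_rel_def by (metis coeff_eq_0)
  then show "degree m' = degree m"
    by (intro antisym degree_le le_degree) (auto simp: 1)
  with 1 show "lead_coeff m' = 1" by simp
qed

text \<open>The extension sends \<open>p(x)\<close> to \<open>p'(y)\<close>; that this is well
  defined is the whole content.\<close>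

lemma adjoin:
  assumes x: "algebraic x" and m: "min_pair x m m'" and y: "poly m' y = 0"
  shows "\<exists>F'. hom_graph F' \<and> F \<subseteq> F' \<and> (x, y) \<in> F'"
proof -
  have min: "degree m \<le> degree p" if "poly_rel F p p'" "p \<noteq> 0" "poly p x = 0" for p p'
    using m that unfolding min_pair_def by blast
  have mm: "poly_rel F m m'" "lead_coeff m = 1" "poly m x = 0" using m by (auto simp: min_pair_def)
  \<comment> \<open>Division by \<open>m\<close>, carried out on \<open>p\<close> and
    \<open>p'\<close> in parallel and one leading term at a time; the remainder of lower degree
    still vanishes at \<open>x\<close>.\<close>
  have key: "poly p' y = 0" if "poly_rel F p p'" "poly p x = 0" for p p'
    using that
  proof (induction "degree p" arbitrary: p p' rule: less_induct)
    case less
    show ?case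
    proof (cases "p = 0")
      case True
      then have "p' = 0" using less.prems(1) poly_rel_0 by blast
      then show ?thesis by simp
    next
      case False
      then have le: "degree m \<le> degree p" using less.prems min by blast
      define c c' where "c = lead_coeff p" and "c' = coeff p' (degree p)"
      define k where "k = degree p - degree m"
      define r r' where "r = p - monom c k * m" and "r' = p' - monom c' k * m'"
      have "(c, c') \<in> F" using less.prems(1) by (simp add: c_def c'_def poly_rel_def)
      then have rel: "poly_rel F r r'"
        unfolding r_def r'_def by (intro poly_rel_diff poly_rel_mult poly_rel_monom less.prems mm)
      have "poly r x = 0" using less.prems mm by (simp add: r_def)
      have c0: "c \<noteq> 0" using False by (simp add: c_def)
      have m0: "m \<noteq> 0" using mm(2) by force
      have deg: "degree (monom c k * m) = degree p"
        using c0 m0 le by (simp add: degree_mult_eq degree_monom_eq k_def)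
      have "coeff (monom c k * m) (degree p) = c"
        using mm(2) le by (simp add: coeff_monom_mult k_def)
      then have "coeff r (degree p) = 0" by (simp add: r_def c_def)
      moreover have "degree r \<le> degree p" unfolding r_def by (rule degree_diff_le) (auto simp: deg)
      moreover have "degree p > 0" using min_pair_degree(1)[OF m] le by simp
      ultimately have "degree r < degree p"
        by (metis degree_0 le_neq_implies_less leading_coeff_0_iff)
      then have "poly r' y = 0" using less.hyps rel \<open>poly r x = 0\<close> by blast
      then show ?thesis using y by (simp add: r'_def)
    qed
  qed
  define F' where "F' = {(poly p x, poly p' y) | p p'. poly_rel F p p'}"
  have intro: "(poly p x, poly p' y) \<in> F'" if "poly_rel F p p'" for p p'
    using that unfolding F'_def by blast
  have sub: "(u, v) \<in> F'" if "(u, v) \<in> F" for u v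
    using intro[OF poly_rel_monom[OF that, of 0]] by (simp add: monom_0)
  have "hom_graph F'"
    unfolding hom_graph_def
  proof (intro conjI ballI allI impI)
    fix q :: complex assume "q \<in> \<rat>"
    then show "(q, q) \<in> F'" by (intro sub rat)
  next
    fix a a' b b' assume "(a, a') \<in> F'" "(b, b') \<in> F'"
    then obtain p p' q q' where pq: "poly_rel F p p'" "poly_rel F q q'"
      "a = poly p x" "a' = poly p' y" "b = poly q x" "b' = poly q' y" by (auto simp: F'_def)
    show "(a + b, a' + b') \<in> F'" using intro[OF poly_rel_add[OF pq(1,2)]] pq by simp
    show "(a * b, a' * b') \<in> F'" using intro[OF poly_rel_mult[OF pq(1,2)]] pq by simp
  next
    fix z assume "(0, z) \<in> F'"
    then show "z = 0" using key unfolding F'_def by force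
  next
    fix u v assume "(u, v) \<in> F'"
    then obtain p p' where p: "poly_rel F p p'" "u = poly p x" by (auto simp: F'_def)
    have "algebraic (coeff p i)" for i using p(1) alg unfolding poly_rel_def by blast
    then show "algebraic u" unfolding p(2) by (rule poly_algebraic[OF x])
  qed
  moreover have "(x, y) \<in> F'" using intro[OF poly_rel_monom[OF one, of 1]] by (simp add: poly_monom)
  ultimately show ?thesis using sub by auto
qed

end

lemma hom_graph_Union_chain:
  assumes "C \<noteq> {}" "subset.chain {F. hom_graph F} C"
  shows "hom_graph (\<Union>C)"
proof -
  have hg: "hom_graph F" if "F \<in> C" for F using assms(2) that by (auto simp: subset.chain_def)
  have two: "\<exists>F\<in>C. u \<in> F \<and> v \<in> F" if uv: "u \<in> \<Union>C" "v \<in> \<Union>C" for u v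
  proof -
    obtain F G where FG: "F \<in> C" "G \<in> C" "u \<in> F" "v \<in> G" using uv by blast
    then have "F \<subseteq> G \<or> G \<subseteq> F" using assms(2) by (auto simp: subset_chain_def)
    then show ?thesis using FG by blast
  qed
  show ?thesis
    unfolding hom_graph_def
  proof (intro conjI ballI allI impI)
    fix q :: complex assume "q \<in> \<rat>"
    then show "(q, q) \<in> \<Union>C" using assms(1) hg unfolding hom_graph_def by blast
  next
    fix a a' b b' assume "(a, a') \<in> \<Union>C" "(b, b') \<in> \<Union>C"
    then obtain F where "F \<in> C" "(a, a') \<in> F" "(b, b') \<in> F" using two by blast
    then show "(a + b, a' + b') \<in> \<Union>C" "(a * b, a' * b') \<in> \<Union>C"
      using hg[of F] unfolding hom_graph_def by blast+
  next
    fix z assume "(0, z) \<in> \<Union>C"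
    then show "z = 0" using hg unfolding hom_graph_def by blast
  next
    fix u v assume "(u, v) \<in> \<Union>C"
    then show "algebraic u" using hg unfolding hom_graph_def by blast
  qed
qed

lemma total_hom_graph_galois:
  assumes "hom_graph F" and total: "\<And>x. algebraic x \<Longrightarrow> \<exists>y. (x, y) \<in> F"
  shows "\<exists>s\<in>abs_galois. \<forall>x y. (x, y) \<in> F \<longrightarrow> s x = y"
proof -
  interpret hom_graph_on F by unfold_locales (fact assms)
  define s where "s = (\<lambda>x. THE y. (x, y) \<in> F)"
  have s: "s x = y" if "(x, y) \<in> F" for x y
    unfolding s_def using that single_valued by blast
  have sF: "(x, s x) \<in> F" if "algebraic x" for x using total[OF that] s by blast
  have root: "poly q (s x) = 0" if "\<And>i. coeff q i \<in> \<int>" "poly q x = 0" "algebraic x" for q x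
    using that Ints_subset_Rats by (intro poly_root[OF sF[OF that(3)]]) auto
  have alg: "algebraic (s x)" if x: "algebraic x" for x
  proof -
    obtain q where "\<And>i. coeff q i \<in> \<int>" "poly q x = 0" "q \<noteq> 0" using x by (auto simp: algebraic_def)
    then show ?thesis using root[of q x] x by (intro algebraicI[of q]) auto
  qed
  have injs: "inj_on s Qbar"
    using inj sF unfolding inj_on_def Qbar_def by (metis mem_Collect_eq)
  \<comment> \<open>An injective \<open>s\<close> permutes the finitely many roots of an integer
    polynomial, hence reaches each of them.\<close>
  have surj: "y \<in> s ` Qbar" if y: "y \<in> Qbar" for y
  proof -
    obtain q where q: "\<And>i. coeff q i \<in> \<int>" "poly q y = 0" "q \<noteq> 0"
      using y unfolding Qbar_def algebraic_def by blast
    define Z where "Z = {z. poly q z = 0}"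
    have "finite Z" unfolding Z_def using q(3) by (rule poly_roots_finite)
    have ZQ: "Z \<subseteq> Qbar" using q by (auto simp: Z_def Qbar_def intro!: algebraicI[of q])
    have "s ` Z \<subseteq> Z" using root[OF q(1)] ZQ by (auto simp: Z_def Qbar_def)
    moreover have "inj_on s Z" using injs ZQ inj_on_subset by blast
    ultimately have "s ` Z = Z" using \<open>finite Z\<close> by (metis endo_inj_surj)
    then show ?thesis using q(2) ZQ unfolding Z_def by blast
  qed
  have "bij_betw s Qbar Qbar"
    unfolding bij_betw_def using injs surj alg by (auto simp: Qbar_def)
  moreover have "s 1 = 1" by (rule s[OF one])
  moreover have "s (x + y) = s x + s y \<and> s (x * y) = s x * s y" if "x \<in> Qbar" "y \<in> Qbar" for x y
    using that by (auto simp: Qbar_def intro!: s add mult sF)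
  ultimately have "s \<in> abs_galois" unfolding abs_galois_def by blast
  then show ?thesis using s by blast
qed

text \<open>A maximal homomorphism from Zorn's lemma is total, since the image \<open>m'\<close> of
  a minimal polynomial has a complex root to which \<open>x\<close> can be sent.\<close>

theorem hom_graph_extends:
  assumes "hom_graph F0"
  shows "\<exists>s\<in>abs_galois. \<forall>x y. (x, y) \<in> F0 \<longrightarrow> s x = y"
proof -
  define A where "A = {F. hom_graph F \<and> F0 \<subseteq> F}"
  have "\<exists>M\<in>A. \<forall>X\<in>A. M \<subseteq> X \<longrightarrow> X = M"
  proof (rule subset_Zorn_nonempty)
    show "A \<noteq> {}" using assms by (auto simp: A_def)
    fix C assume C: "C \<noteq> {}" "subset.chain A C"
    then have "subset.chain {F. hom_graph F} C" by (auto simp: subset_chain_def A_def)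
    then have "hom_graph (\<Union>C)" using C hom_graph_Union_chain by blast
    moreover have "F0 \<subseteq> \<Union>C" using C unfolding subset_chain_def A_def by blast
    ultimately show "\<Union>C \<in> A" by (simp add: A_def)
  qed
  then obtain M where M: "hom_graph M" "F0 \<subseteq> M"
    and max: "\<And>X. hom_graph X \<Longrightarrow> M \<subseteq> X \<Longrightarrow> X = M" unfolding A_def by auto
  interpret hom_graph_on M by unfold_locales (fact M)
  have "\<exists>y. (x, y) \<in> M" if x: "algebraic x" for x
  proof -
    obtain m m' where m: "min_pair x m m'" using min_pair_ex[OF x] by blast
    have "\<not> constant (poly m')" using min_pair_degree[OF m] by (simp add: constant_degree)
    then obtain y where "poly m' y = 0" using fundamental_theorem_of_algebra by blast
    then obtain F' where "hom_graph F'" "M \<subseteq> F'" "(x, y) \<in> F'" using adjoin[OF x m] by blast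
    then show ?thesis using max by blast
  qed
  then show ?thesis using total_hom_graph_galois[OF M(1)] M(2) by blast
qed

lemma hom_graph_Rats: "hom_graph {(q, q) | q. q \<in> \<rat>}"
  unfolding hom_graph_def by (auto intro: rat_imp_algebraic)

text \<open>An irrational \<open>x\<close> has a minimal polynomial of degree at least 2. Being
  separable, it has a second root \<open>y\<close>, and some automorphism sends \<open>x\<close> to
  \<open>y\<close>.\<close>

lemma fixed_imp_rational:
  assumes x: "x \<in> Qbar" and fixed: "\<And>s. s \<in> abs_galois \<Longrightarrow> s x = x"
  shows "x \<in> \<rat>"
proof (rule ccontr)
  assume nr: "x \<notin> \<rat>"
  have ax: "algebraic x" using x by (simp add: Qbar_def)
  interpret hom_graph_on "{(q, q) | q. q \<in> \<rat>}" by unfold_locales (rule hom_graph_Rats)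
  have rel: "poly_rel {(q, q) | q. q \<in> \<rat>} p p' \<longleftrightarrow> p = p' \<and> (\<forall>i. coeff p i \<in> \<rat>)" for p p'
    unfolding poly_rel_def by (auto intro: poly_eqI)
  obtain m m' where m: "min_pair x m m'" using min_pair_ex[OF ax] by blast
  then have mm: "m' = m" "\<And>i. coeff m i \<in> \<rat>" "lead_coeff m = 1" "poly m x = 0"
    and min: "\<And>p. (\<And>i. coeff p i \<in> \<rat>) \<Longrightarrow> p \<noteq> 0 \<Longrightarrow> poly p x = 0 \<Longrightarrow> degree m \<le> degree p"
    unfolding min_pair_def rel by auto
  obtain q where q: "m = [:- x, 1:] * q" using mm(4) by (metis dvdE poly_eq_0_iff_dvd)
  have m0: "m \<noteq> 0" using mm(3) by force
  then have q0: "q \<noteq> 0" using q by auto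
  have "degree m = 1 + degree q" unfolding q using q0 by (subst degree_mult_eq) auto
  have "degree q \<noteq> 0"
  proof
    assume "degree q = 0"
    then obtain c where "q = [:c:]" by (rule degree_eq_zeroE)
    then have "m = [:- (x * c), c:]" using q by simp
    moreover then have "c = 1" using mm(3) by (simp split: if_splits)
    ultimately have "- x \<in> \<rat>" using mm(2)[of 0] by simp
    then show False using nr by simp
  qed
  then have "\<not> constant (poly q)" by (simp add: constant_degree)
  then obtain y where y: "poly q y = 0" using fundamental_theorem_of_algebra by blast
  have "y \<noteq> x"
  proof
    assume "y = x"
    \<comment> \<open>A double root would also be a root of the derivative, whose degree is too
      small.\<close>
    have "pderiv m = q + [:- x, 1:] * pderiv q" unfolding q pderiv_mult by (simp add: pderiv_pCons)
    then have "poly (pderiv m) x = 0" using y \<open>y = x\<close> by simp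
    moreover have "degree m > 0" using \<open>degree m = 1 + degree q\<close> by simp
    moreover then have "pderiv m \<noteq> 0" by (simp add: pderiv_eq_0_iff)
    moreover have "coeff (pderiv m) i \<in> \<rat>" for i using mm(2) by (simp add: coeff_pderiv)
    ultimately show False using min[of "pderiv m"] by (simp add: degree_pderiv)
  qed
  have "poly m y = 0" using y by (simp add: q)
  then obtain F' where F': "hom_graph F'" "(x, y) \<in> F'" using adjoin[OF ax m] mm(1) by blast
  then obtain s where "s \<in> abs_galois" "s x = y" using hom_graph_extends by blast
  then show False using fixed \<open>y \<noteq> x\<close> by auto
qed

section \<open>Primes of the ring of algebraic integers and inertia\<close>

lemma Qbar_rat: "q \<in> \<rat> \<Longrightarrow> q \<in> Qbar"
  and Qbar_add: "x \<in> Qbar \<Longrightarrow> y \<in> Qbar \<Longrightarrow> x + y \<in> Qbar"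
  and Qbar_mult: "x \<in> Qbar \<Longrightarrow> y \<in> Qbar \<Longrightarrow> x * y \<in> Qbar"
  by (auto simp: Qbar_def algebraic_add algebraic_mult rat_imp_algebraic)

lemma galois_maps_rat:
  assumes s: "s \<in> abs_galois" and q: "q \<in> \<rat>"
  shows "s q = q"
proof -
  have add: "s (x + y) = s x + s y" and mult: "s (x * y) = s x * s y"
    if "x \<in> \<rat>" "y \<in> \<rat>" for x y
    using s that Qbar_rat unfolding abs_galois_def by auto
  have 1: "s 1 = 1" using s by (simp add: abs_galois_def)
  have 0: "s 0 = 0" using add[of 0 0] by simp
  have n: "s (of_nat n) = of_nat n" for n by (induction n) (simp_all add: 0 1 add)
  have neg: "s (- x) = - s x" if "x \<in> \<rat>" for x
    using add[of x "- x"] that 0 by (simp add: eq_neg_iff_add_eq_0 add.commute)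
  have i: "s (of_int k) = of_int k" for k
    by (cases k rule: int_cases2) (simp_all add: n neg)
  obtain a b where ab: "b > 0" "q = of_int a / of_int b"
    using q by (rule Rats_cases')
  then have b: "b \<noteq> 0" and qab: "q = of_int a / of_int b" by auto
  then have "s q * of_int b = of_int a" using mult[of q "of_int b"] q i by simp
  then show ?thesis using b qab by (metis nonzero_eq_divide_eq of_int_0_eq_iff)
qed

text \<open>Automorphisms are arbitrary functions outside \<open>Qbar\<close>, so the graph is cut
  down to \<open>Qbar\<close>.\<close>

lemma galois_hom_graph:
  assumes s: "s \<in> abs_galois"
  shows "hom_graph {(x, s x) | x. x \<in> Qbar}"
proof -
  have "s 0 = 0" using galois_maps_rat[OF s] by simp
  then show ?thesis
    unfolding hom_graph_def using s galois_maps_rat[OF s] Qbar_rat Qbar_add Qbar_mult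
    by (auto simp: abs_galois_def) (simp add: Qbar_def)
qed

lemma galois_closed: "s \<in> abs_galois \<Longrightarrow> x \<in> Qbar \<Longrightarrow> s x \<in> Qbar"
  by (auto simp: abs_galois_def bij_betw_def)

lemma galois_add: "s \<in> abs_galois \<Longrightarrow> x \<in> Qbar \<Longrightarrow> y \<in> Qbar \<Longrightarrow> s (x + y) = s x + s y"
  and galois_mult: "s \<in> abs_galois \<Longrightarrow> x \<in> Qbar \<Longrightarrow> y \<in> Qbar \<Longrightarrow> s (x * y) = s x * s y"
  by (simp_all add: abs_galois_def)

lemma galois_inj: "s \<in> abs_galois \<Longrightarrow> x \<in> Qbar \<Longrightarrow> y \<in> Qbar \<Longrightarrow> s x = s y \<longleftrightarrow> x = y"
  unfolding abs_galois_def bij_betw_def by (auto simp: inj_on_eq_iff)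

lemma Qbar_diff: "x \<in> Qbar \<Longrightarrow> y \<in> Qbar \<Longrightarrow> x - y \<in> Qbar"
  using Qbar_add[of x "(-1) * y"] Qbar_mult[of "-1" y] Qbar_rat[of "-1"] by simp

lemma galois_diff: "s \<in> abs_galois \<Longrightarrow> x \<in> Qbar \<Longrightarrow> y \<in> Qbar \<Longrightarrow> s (x - y) = s x - s y"
  using galois_add[of s "x - y" y] Qbar_diff[of x y] by simp

lemma Qbar_power: "x \<in> Qbar \<Longrightarrow> x ^ n \<in> Qbar"
  by (induction n) (auto intro: Qbar_mult Qbar_rat)

lemma galois_power: "s \<in> abs_galois \<Longrightarrow> x \<in> Qbar \<Longrightarrow> s (x ^ n) = s x ^ n"
  by (induction n) (auto simp: galois_maps_rat galois_mult Qbar_power)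

lemma Qbar_sum: "(\<And>i. i \<in> I \<Longrightarrow> f i \<in> Qbar) \<Longrightarrow> (\<Sum>i\<in>I. f i) \<in> Qbar"
  by (induction I rule: infinite_finite_induct) (auto intro: Qbar_add Qbar_rat)

lemma Qbar_prod: "(\<And>i. i \<in> I \<Longrightarrow> f i \<in> Qbar) \<Longrightarrow> (\<Prod>i\<in>I. f i) \<in> Qbar"
  by (induction I rule: infinite_finite_induct) (auto intro: Qbar_mult Qbar_rat)

lemma galois_sum:
  "s \<in> abs_galois \<Longrightarrow> (\<And>i. i \<in> I \<Longrightarrow> f i \<in> Qbar) \<Longrightarrow> s (\<Sum>i\<in>I. f i) = (\<Sum>i\<in>I. s (f i))"
  by (induction I rule: infinite_finite_induct) (auto simp: galois_maps_rat galois_add Qbar_sum)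

lemma galois_prod:
  "s \<in> abs_galois \<Longrightarrow> (\<And>i. i \<in> I \<Longrightarrow> f i \<in> Qbar) \<Longrightarrow> s (\<Prod>i\<in>I. f i) = (\<Prod>i\<in>I. s (f i))"
  by (induction I rule: infinite_finite_induct) (auto simp: galois_maps_rat galois_mult Qbar_prod)

lemma galois_id: "id \<in> abs_galois"
  by (simp add: abs_galois_def)

lemma galois_comp:
  assumes "s \<in> abs_galois" "t \<in> abs_galois"
  shows "s \<circ> t \<in> abs_galois"
  using assms galois_closed[OF assms(2)] bij_betw_trans[of t Qbar Qbar s Qbar]
  by (auto simp: abs_galois_def)

lemma galois_algebraic_int:
  assumes s: "s \<in> abs_galois" and x: "algebraic_int x"
  shows "algebraic_int (s x)"
proof -
  interpret hom_graph_on "{(x, s x) | x. x \<in> Qbar}" by unfold_locales (rule galois_hom_graph[OF s])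
  from x obtain p where p: "lead_coeff p = 1" "\<And>i. coeff p i \<in> \<int>" "poly p x = 0"
    by cases auto
  have "(x, s x) \<in> {(x, s x) | x. x \<in> Qbar}"
    using x by (auto simp: Qbar_def)
  then have "poly p (s x) = 0"
    using p Ints_subset_Rats by (intro poly_root[of x "s x" p]) auto
  then show ?thesis using p by (intro algebraic_int.intros[of p]) auto
qed

text \<open>The algebraic integers; quantifying over the conjugates makes Galois stability immediate.\<close>

definition OQ :: "complex set" where
  "OQ = {x \<in> Qbar. \<forall>s\<in>abs_galois. fin_pow \<int> (s x)}"

lemma OQ_Qbar: "x \<in> OQ \<Longrightarrow> x \<in> Qbar"
  by (simp add: OQ_def)

lemma OQ_algebraic_int: "algebraic_int x \<Longrightarrow> x \<in> OQ"
  by (auto simp: OQ_def Qbar_def galois_algebraic_int algebraic_int_imp_fin_pow)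

lemma OQ_of_int: "of_int k \<in> OQ"
  by (simp add: OQ_algebraic_int int_imp_algebraic_int)

lemma OQ_0: "0 \<in> OQ" and OQ_1: "1 \<in> OQ"
  using OQ_of_int[of 0] OQ_of_int[of 1] by simp_all

lemma OQ_add: "x \<in> OQ \<Longrightarrow> y \<in> OQ \<Longrightarrow> x + y \<in> OQ"
  by (simp add: OQ_def Qbar_add galois_add fin_pow_add)

lemma OQ_mult: "x \<in> OQ \<Longrightarrow> y \<in> OQ \<Longrightarrow> x * y \<in> OQ"
  by (simp add: OQ_def Qbar_mult galois_mult fin_pow_mult)

lemma OQ_diff: "x \<in> OQ \<Longrightarrow> y \<in> OQ \<Longrightarrow> x - y \<in> OQ"
  using OQ_add[of x "of_int (-1) * y"] OQ_mult[of "of_int (-1)" y] OQ_of_int[of "-1"] by simp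

lemma OQ_prod: "(\<And>i. i \<in> I \<Longrightarrow> f i \<in> OQ) \<Longrightarrow> (\<Prod>i\<in>I. f i) \<in> OQ"
  by (induction I rule: infinite_finite_induct) (auto intro: OQ_mult OQ_1)

lemma OQ_sum: "(\<And>i. i \<in> I \<Longrightarrow> f i \<in> OQ) \<Longrightarrow> (\<Sum>i\<in>I. f i) \<in> OQ"
  by (induction I rule: infinite_finite_induct) (auto intro: OQ_add OQ_0)

lemma OQ_galois:
  assumes s: "s \<in> abs_galois" and x: "x \<in> OQ"
  shows "s x \<in> OQ"
proof -
  have "fin_pow \<int> (t (s x))" if "t \<in> abs_galois" for t
    using x galois_comp[OF that s] by (auto simp: OQ_def)
  then show ?thesis using galois_closed[OF s] x by (simp add: OQ_def)
qed

lemma OQ_rational: "x \<in> OQ \<Longrightarrow> x \<in> \<rat> \<Longrightarrow> x \<in> \<int>"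
  using fin_pow_Ints_rational[of x] galois_id by (auto simp: OQ_def)

lemma OQ_fixed:
  assumes "x \<in> OQ" "\<And>s. s \<in> abs_galois \<Longrightarrow> s x = x"
  shows "\<exists>k::int. x = of_int k"
proof -
  have "x \<in> \<rat>" by (rule fixed_imp_rational) (use assms OQ_Qbar in auto)
  then show ?thesis using OQ_rational[OF assms(1)] by (auto elim: Ints_cases)
qed

section \<open>Prime ideals over a rational prime\<close>

definition ideal_OQ :: "complex set \<Rightarrow> bool" where
  "ideal_OQ M \<longleftrightarrow> M \<subseteq> OQ \<and> (\<forall>x\<in>M. \<forall>y\<in>M. x + y \<in> M) \<and> (\<forall>x\<in>M. \<forall>y\<in>OQ. x * y \<in> M)"

lemma proper_ideal_Union_chain:
  assumes "C \<noteq> {}" "subset.chain {I. ideal_OQ I \<and> z \<in> I \<and> 1 \<notin> I} C"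
  shows "\<Union>C \<in> {I. ideal_OQ I \<and> z \<in> I \<and> 1 \<notin> I}"
proof -
  have hg: "ideal_OQ I" "z \<in> I" "1 \<notin> I" if "I \<in> C" for I
    using assms(2) that by (auto simp: subset_chain_def)
  have two: "\<exists>F\<in>C. u \<in> F \<and> v \<in> F" if uv: "u \<in> \<Union>C" "v \<in> \<Union>C" for u v
  proof -
    obtain F G where FG: "F \<in> C" "G \<in> C" "u \<in> F" "v \<in> G" using uv by blast
    then have "F \<subseteq> G \<or> G \<subseteq> F" using assms(2) by (auto simp: subset_chain_def)
    then show ?thesis using FG by blast
  qed
  have "x + y \<in> \<Union>C" if xy: "x \<in> \<Union>C" "y \<in> \<Union>C" for x y
  proof -
    obtain F where "F \<in> C" "x \<in> F" "y \<in> F" using two[OF xy] by blast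
    then show ?thesis using hg(1)[of F] unfolding ideal_OQ_def by blast
  qed
  moreover have "x * y \<in> \<Union>C" if "x \<in> \<Union>C" "y \<in> OQ" for x y
    using that hg(1) unfolding ideal_OQ_def by blast
  moreover have "\<Union>C \<subseteq> OQ" using hg(1) unfolding ideal_OQ_def by blast
  ultimately have "ideal_OQ (\<Union>C)" unfolding ideal_OQ_def by blast
  then show ?thesis using hg(2,3) assms(1) by blast
qed

locale prime_over =
  fixes p :: int and M :: "complex set"
  assumes p: "prime p" and ideal: "ideal_OQ M" and pM: "of_int p \<in> M" and one: "1 \<notin> M"
    and prime: "\<And>x y. x \<in> OQ \<Longrightarrow> y \<in> OQ \<Longrightarrow> x * y \<in> M \<Longrightarrow> x \<in> M \<or> y \<in> M"

text \<open>\<open>M\<close> is maximal among the proper ideals containing \<open>p\<close>. The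
  ideal \<open>p OQ\<close> is proper because \<open>1 / p\<close> is rational but not an
  integer.\<close>

lemma prime_over_ex:
  assumes p: "prime (p::int)"
  shows "\<exists>M. prime_over p M"
proof -
  define z :: complex where "z = of_int p"
  define A where "A = {I. ideal_OQ I \<and> z \<in> I \<and> 1 \<notin> I}"
  have p0: "p \<noteq> 0" using p by auto
  have "\<exists>M\<in>A. \<forall>X\<in>A. M \<subseteq> X \<longrightarrow> X = M"
  proof (rule subset_Zorn_nonempty)
    define I where "I = (\<lambda>x. z * x) ` OQ"
    have "ideal_OQ I"
      unfolding ideal_OQ_def
    proof (intro conjI ballI)
      show "I \<subseteq> OQ" by (auto simp: I_def z_def intro: OQ_mult OQ_of_int)
    next
      fix x y assume "x \<in> I" "y \<in> I"
      then obtain a b where "a \<in> OQ" "b \<in> OQ" "x + y = z * (a + b)" by (auto simp: I_def distrib_left)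
      then show "x + y \<in> I" unfolding I_def using OQ_add by blast
    next
      fix x y assume "x \<in> I" "y \<in> OQ"
      then obtain a where "a \<in> OQ" "x * y = z * (a * y)" by (auto simp: I_def)
      then show "x * y \<in> I" unfolding I_def using OQ_mult \<open>y \<in> OQ\<close> by blast
    qed
    moreover have "z \<in> I" using OQ_1 by (force simp: I_def)
    moreover have "1 \<notin> I"
    proof
      assume "1 \<in> I"
      then obtain x where x: "x \<in> OQ" "1 = z * x" by (auto simp: I_def)
      then have "x = 1 / of_int p" using p0 by (simp add: z_def field_simps)
      then have "x \<in> \<rat>" by simp
      then obtain k where k: "x = of_int k" using OQ_rational x(1) by (auto elim: Ints_cases)
      have "(of_int (p * k) :: complex) = of_int 1" using x(2) by (simp add: z_def k)
      then have "p * k = 1" by (simp only: of_int_eq_iff)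
      then have "p dvd 1" by (metis dvd_triv_left)
      then show False using p not_prime_unit by blast
    qed
    ultimately show "A \<noteq> {}" unfolding A_def by blast
  next
    fix C assume "C \<noteq> {}" "subset.chain A C"
    then show "\<Union>C \<in> A" unfolding A_def by (rule proper_ideal_Union_chain)
  qed
  then obtain M where M: "ideal_OQ M" "z \<in> M" "1 \<notin> M"
    and max: "\<And>X. ideal_OQ X \<Longrightarrow> 1 \<notin> X \<Longrightarrow> M \<subseteq> X \<Longrightarrow> X = M" unfolding A_def by auto
  have MO: "M \<subseteq> OQ" and Madd: "\<And>x y. x \<in> M \<Longrightarrow> y \<in> M \<Longrightarrow> x + y \<in> M"
    and Mmult: "\<And>x y. x \<in> M \<Longrightarrow> y \<in> OQ \<Longrightarrow> x * y \<in> M"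
    using M(1) unfolding ideal_OQ_def by blast+
  have M0: "0 \<in> M" using Mmult[OF M(2) OQ_0] by simp
  have prime: "y \<in> M" if x: "x \<in> OQ" and y: "y \<in> OQ" and xy: "x * y \<in> M" and nx: "x \<notin> M" for x y
  proof -
    \<comment> \<open>The ideal generated by \<open>M\<close> and \<open>x\<close>. Maximality
      forces 1 into it, and multiplying that relation by \<open>y\<close> gives
      \<open>y \<in> M\<close>.\<close>
    define X where "X = {m + x * r | m r. m \<in> M \<and> r \<in> OQ}"
    have XI: "m + x * r \<in> X" if "m \<in> M" "r \<in> OQ" for m r unfolding X_def using that by blast
    have "ideal_OQ X"
      unfolding ideal_OQ_def
    proof (intro conjI ballI)
      show "X \<subseteq> OQ" using MO x by (auto simp: X_def intro!: OQ_add OQ_mult)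
    next
      fix u v assume "u \<in> X" "v \<in> X"
      then obtain m r m' r' where h: "m \<in> M" "r \<in> OQ" "m' \<in> M" "r' \<in> OQ" "u = m + x * r" "v = m' + x * r'"
        by (auto simp: X_def)
      then have "u + v = (m + m') + x * (r + r')" by (simp add: algebra_simps)
      then show "u + v \<in> X" using XI[OF Madd[OF h(1,3)] OQ_add[OF h(2,4)]] by simp
    next
      fix u v assume "u \<in> X" and v: "v \<in> OQ"
      then obtain m r where h: "m \<in> M" "r \<in> OQ" "u = m + x * r" by (auto simp: X_def)
      then have "u * v = m * v + x * (r * v)" by (simp add: algebra_simps)
      then show "u * v \<in> X" using XI[OF Mmult[OF h(1) v] OQ_mult[OF h(2) v]] by simp
    qed
    moreover have "M \<subseteq> X" using XI[OF _ OQ_0] by auto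
    moreover have "x \<in> X" using XI[OF M0 OQ_1] by simp
    ultimately have "1 \<in> X" using max nx by blast
    then obtain m r where h: "m \<in> M" "r \<in> OQ" "1 = m + x * r" by (auto simp: X_def)
    then have "y = m * y + x * y * r" by (metis distrib_right mult.assoc mult.commute mult_1)
    then show "y \<in> M" using Madd[OF Mmult[OF h(1) y] Mmult[OF xy h(2)]] by simp
  qed
  have "prime_over p M"
    by unfold_locales (use p M prime in \<open>auto simp: z_def\<close>)
  then show ?thesis by blast
qed

text \<open>The algebraic integers in the field generated by a Galois stable set \<open>X\<close>.\<close>

definition fixed_ring :: "complex set \<Rightarrow> complex set" where
  "fixed_ring X = {x \<in> OQ. \<forall>s\<in>abs_galois. \<forall>t\<in>abs_galois. (\<forall>y\<in>X. s y = t y) \<longrightarrow> s x = t x}"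

context prime_over
begin

lemma M_OQ: "x \<in> M \<Longrightarrow> x \<in> OQ"
  and M_add: "x \<in> M \<Longrightarrow> y \<in> M \<Longrightarrow> x + y \<in> M"
  and M_mult: "x \<in> M \<Longrightarrow> y \<in> OQ \<Longrightarrow> x * y \<in> M"
  using ideal unfolding ideal_OQ_def by blast+

lemma M_mult': "x \<in> OQ \<Longrightarrow> y \<in> M \<Longrightarrow> x * y \<in> M"
  using M_mult[of y x] by (simp add: mult.commute)

lemma M_0: "0 \<in> M"
  using M_mult[OF pM OQ_0] by simp

lemma M_diff: "x \<in> M \<Longrightarrow> y \<in> M \<Longrightarrow> x - y \<in> M"
  using M_add[of x "y * of_int (-1)"] M_mult[of y "of_int (-1)"] OQ_of_int[of "-1"] by simp

lemma M_sum: "(\<And>i. i \<in> I \<Longrightarrow> f i \<in> M) \<Longrightarrow> (\<Sum>i\<in>I. f i) \<in> M"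
  by (induction I rule: infinite_finite_induct) (auto intro: M_add M_0)

text \<open>An integer not divisible by \<open>p\<close> is coprime to it, and a Bezout relation
  would put 1 into \<open>M\<close>.\<close>

lemma M_of_int: "of_int k \<in> M \<longleftrightarrow> p dvd k"
proof
  assume k: "of_int k \<in> M"
  show "p dvd k"
  proof (rule ccontr)
    assume "\<not> p dvd k"
    then have "coprime p k" using p by (simp add: prime_imp_coprime)
    then obtain a b where ab: "a * p + b * k = 1"
      by (metis bezout_int coprime_imp_gcd_eq_1)
    have "of_int p * of_int a + of_int k * of_int b \<in> M"
      by (intro M_add M_mult pM k OQ_of_int)
    also have "of_int p * of_int a + of_int k * of_int b = (of_int (a * p + b * k) :: complex)"
      by (simp add: mult.commute)
    finally show False using one ab by simp
  qed
next
  assume "p dvd k"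
  then show "of_int k \<in> M" using M_mult[OF pM OQ_of_int] by (auto elim!: dvdE)
qed

lemma M_square: "x \<in> OQ \<Longrightarrow> x ^ 2 \<in> M \<Longrightarrow> x \<in> M"
  using prime[of x x] by (auto simp: power2_eq_square)

lemma M_prod: "finite I \<Longrightarrow> (\<And>i. i \<in> I \<Longrightarrow> f i \<in> OQ) \<Longrightarrow> (\<Prod>i\<in>I. f i) \<in> M \<Longrightarrow> \<exists>i\<in>I. f i \<in> M"
proof (induction I rule: finite_induct)
  case (insert i I)
  then show ?case using prime[of "f i" "\<Prod>i\<in>I. f i"] OQ_prod[of I f] by auto
qed (use one in simp)

text \<open>If inertia were trivial, each \<open>g \<noteq> 1\<close> in the finite Galois group would move some \<open>w\<^sub>g\<close> modulo \<open>M\<close>.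
  Expanding \<open>\<Sum>\<^sub>g g(r) \<Prod>\<^sub>h (g(w\<^sub>h) - h(w\<^sub>h))\<close> over \<open>h \<noteq> 1\<close> expresses it through traces of multiples of \<open>r\<close>, which
  are integers divisible by \<open>p\<close>; but only the term \<open>g = 1\<close> survives, and it is \<open>r\<close> times an element
  outside \<open>M\<close>. Squaring contradicts \<open>r\<^sup>2 = p u\<close>.\<close>

lemma ramified_imp_inertia:
  assumes X: "finite X" "X \<subseteq> OQ" "\<And>s x. s \<in> abs_galois \<Longrightarrow> x \<in> X \<Longrightarrow> s x \<in> X"
    and r: "r \<in> fixed_ring X" "r ^ 2 = of_int (p * u)" "\<not> p dvd u"
  shows "\<exists>s\<in>abs_galois. (\<exists>x\<in>X. s x \<noteq> x) \<and> (\<forall>x\<in>fixed_ring X. s x - x \<in> M)"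
proof (rule ccontr)
  assume "\<not> ?thesis"
  then have nontriv: "\<exists>x\<in>fixed_ring X. s x - x \<notin> M" if "s \<in> abs_galois" "\<exists>x\<in>X. s x \<noteq> x" for s
    using that by blast
  define A where "A = fixed_ring X"
  have AO: "x \<in> OQ" if "x \<in> A" for x using that by (simp add: A_def fixed_ring_def)
  have AQ: "x \<in> Qbar" if "x \<in> A" for x using AO that OQ_Qbar by blast
  have Acong: "s x = t x" if "x \<in> A" "s \<in> abs_galois" "t \<in> abs_galois" "restrict s X = restrict t X" for s t x
  proof -
    have "s y = t y" if "y \<in> X" for y using \<open>restrict s X = restrict t X\<close> that by (metis restrict_apply')
    then show ?thesis using that unfolding A_def fixed_ring_def by blast
  qed
  have Amult: "x * y \<in> A" if "x \<in> A" "y \<in> A" for x y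
  proof -
    have "s (x * y) = t (x * y)" if st: "s \<in> abs_galois" "t \<in> abs_galois" "\<forall>y\<in>X. s y = t y" for s t
    proof -
      have "s x = t x" "s y = t y" using \<open>x \<in> A\<close> \<open>y \<in> A\<close> st unfolding A_def fixed_ring_def by blast+
      then show ?thesis using st(1,2) AQ \<open>x \<in> A\<close> \<open>y \<in> A\<close> by (simp add: galois_mult)
    qed
    then show ?thesis using AO that unfolding A_def fixed_ring_def by (simp add: OQ_mult)
  qed
  have A1: "1 \<in> A" unfolding A_def fixed_ring_def by (simp add: OQ_1 galois_maps_rat)
  \<comment> \<open>\<open>G\<close> is the Galois group of the field generated by \<open>X\<close>,
    as a finite set of restrictions.\<close>
  define G where "G = (\<lambda>s. restrict s X) ` abs_galois"
  have "G \<subseteq> X \<rightarrow>\<^sub>E X" using X(3) by (auto simp: G_def)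
  then have finG: "finite G" using X(1) by (meson finite_PiE finite_subset)
  \<comment> \<open>Elements of \<open>G\<close> act only on \<open>X\<close>; a lift lets them act
    on \<open>A\<close>, where by \<open>Acong\<close> the values do not depend on the choice. So
    \<open>\<rho> e\<close> may differ from \<open>id\<close>, but it fixes \<open>A\<close>
    pointwise.\<close>
  define \<rho> where "\<rho> = (\<lambda>g. SOME s. s \<in> abs_galois \<and> restrict s X = g)"
  have \<rho>: "\<rho> g \<in> abs_galois" "restrict (\<rho> g) X = g" if "g \<in> G" for g
  proof -
    have "\<exists>s. s \<in> abs_galois \<and> restrict s X = g" using that unfolding G_def by blast
    then have "\<rho> g \<in> abs_galois \<and> restrict (\<rho> g) X = g" unfolding \<rho>_def by (rule someI_ex)
    then show "\<rho> g \<in> abs_galois" "restrict (\<rho> g) X = g" by auto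
  qed
  define e where "e = restrict id X"
  have eG: "e \<in> G" unfolding G_def e_def using galois_id by blast
  have \<rho>e: "\<rho> e x = x" if "x \<in> A" for x
    using Acong[OF that \<rho>(1)[OF eG] galois_id] \<rho>(2)[OF eG] by (simp add: e_def)
  have "\<exists>x\<in>A. \<rho> g x - x \<notin> M" if "g \<in> G - {e}" for g
  proof -
    have "\<exists>x\<in>X. \<rho> g x \<noteq> x"
    proof (rule ccontr)
      assume "\<not> ?thesis"
      then have "restrict (\<rho> g) X = restrict id X" by (intro restrict_ext) auto
      then show False using \<rho>(2) that by (auto simp: e_def)
    qed
    then show ?thesis using nontriv \<rho>(1) that unfolding A_def by blast
  qed
  then obtain w where w: "\<And>g. g \<in> G - {e} \<Longrightarrow> w g \<in> A" "\<And>g. g \<in> G - {e} \<Longrightarrow> \<rho> g (w g) - w g \<notin> M"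
    by metis
  have rA: "r \<in> A" using r(1) by (simp add: A_def)
  have rM: "\<rho> g r \<in> M" if "g \<in> G" for g
  proof -
    have "\<rho> g r ^ 2 = \<rho> g (r ^ 2)" using galois_power[OF \<rho>(1)[OF that] AQ[OF rA]] by simp
    also have "\<dots> = of_int (p * u)" unfolding r(2) by (rule galois_maps_rat[OF \<rho>(1)[OF that]]) simp
    finally have "\<rho> g r ^ 2 \<in> M" by (simp add: M_of_int del: of_int_mult)
    then show ?thesis using M_square OQ_galois[OF \<rho>(1)[OF that] AO[OF rA]] by blast
  qed
  \<comment> \<open>The trace of \<open>r * x\<close> is Galois invariant, hence an integer, and
    lies in \<open>M\<close> because every conjugate of \<open>r\<close> does.\<close>
  have trace: "\<exists>k. (\<Sum>g\<in>G. \<rho> g r * \<rho> g x) = of_int p * of_int k" if x: "x \<in> A" for x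
  proof -
    define T where "T = (\<Sum>g\<in>G. \<rho> g (r * x))"
    have T: "T = (\<Sum>g\<in>G. \<rho> g r * \<rho> g x)"
      unfolding T_def using \<rho>(1) AQ[OF rA] AQ[OF x] by (intro sum.cong) (auto simp: galois_mult)
    have rx: "r * x \<in> A" using Amult rA x by blast
    have "T \<in> OQ" unfolding T_def by (rule OQ_sum) (rule OQ_galois[OF \<rho>(1) AO[OF rx]])
    moreover have "t T = T" if t: "t \<in> abs_galois" for t
    proof -
      define f where "f = (\<lambda>g. restrict (t \<circ> \<rho> g) X)"
      have "f g \<in> G" if "g \<in> G" for g
        unfolding f_def by (subst G_def) (rule imageI[OF galois_comp[OF t \<rho>(1)[OF that]]])
      then have fG: "f ` G \<subseteq> G" by blast
      have "inj_on f G"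
      proof (rule inj_onI)
        fix g h assume gh: "g \<in> G" "h \<in> G" "f g = f h"
        have "\<rho> g y = \<rho> h y" if y: "y \<in> X" for y
        proof -
          have "t (\<rho> g y) = t (\<rho> h y)" using gh(3) y unfolding f_def by (metis comp_apply restrict_apply')
          then show ?thesis using galois_inj[OF t] X(2,3) y \<rho>(1) gh(1,2) OQ_Qbar by (metis subsetD)
        qed
        then have "restrict (\<rho> g) X = restrict (\<rho> h) X" by (intro restrict_ext)
        then show "g = h" using \<rho>(2) gh by metis
      qed
      then have fG': "f ` G = G" using fG finG by (metis endo_inj_surj)
      have "t T = (\<Sum>g\<in>G. t (\<rho> g (r * x)))"
        unfolding T_def by (rule galois_sum[OF t]) (rule galois_closed[OF \<rho>(1) AQ[OF rx]])
      also have "\<dots> = (\<Sum>g\<in>G. \<rho> (f g) (r * x))"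
      proof (rule sum.cong)
        fix g assume g: "g \<in> G"
        have fgG: "f g \<in> G" using fG g by blast
        have "(t \<circ> \<rho> g) (r * x) = \<rho> (f g) (r * x)"
          by (rule Acong[OF rx galois_comp[OF t \<rho>(1)[OF g]] \<rho>(1)[OF fgG]], rule trans[OF _ \<rho>(2)[OF fgG, symmetric]])
             (simp add: f_def)
        then show "t (\<rho> g (r * x)) = \<rho> (f g) (r * x)" by simp
      qed simp
      also have "\<dots> = (\<Sum>g\<in>f ` G. \<rho> g (r * x))" by (simp add: sum.reindex[OF \<open>inj_on f G\<close>])
      finally show ?thesis by (simp add: fG' T_def)
    qed
    ultimately obtain k where k: "T = of_int k" using OQ_fixed by blast
    have "T \<in> M" unfolding T by (rule M_sum, rule M_mult, erule rM) (rule OQ_galois[OF \<rho>(1) AO[OF x]])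
    then obtain l where "k = p * l" unfolding k M_of_int by (auto elim: dvdE)
    then show ?thesis using k T by auto
  qed
  have step: "\<exists>y\<in>OQ. (\<Sum>g\<in>G. \<rho> g r * \<rho> g x * (\<Prod>h\<in>S. \<rho> g (w h) - \<rho> h (w h))) = of_int p * y"
    if "finite S" "S \<subseteq> G - {e}" "x \<in> A" for S x
    using that
  proof (induction S arbitrary: x rule: finite_induct)
    case empty
    then show ?case using trace[of x] OQ_of_int by auto
  next
    case (insert h S)
    have h: "h \<in> G" "w h \<in> A" using insert.prems w(1) by auto
    obtain y where y: "y \<in> OQ"
      "(\<Sum>g\<in>G. \<rho> g r * \<rho> g (x * w h) * (\<Prod>h\<in>S. \<rho> g (w h) - \<rho> h (w h))) = of_int p * y"
      using insert.IH[of "x * w h"] insert.prems Amult h by auto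
    obtain z where z: "z \<in> OQ"
      "(\<Sum>g\<in>G. \<rho> g r * \<rho> g x * (\<Prod>h\<in>S. \<rho> g (w h) - \<rho> h (w h))) = of_int p * z"
      using insert.IH[of x] insert.prems by auto
    \<comment> \<open>In the new factor, \<open>\<rho> g (w h)\<close> is absorbed into the argument
      \<open>x\<close>, while \<open>\<rho> h (w h)\<close> is independent of \<open>g\<close> and
      leaves the sum.\<close>
    have "(\<Sum>g\<in>G. \<rho> g r * \<rho> g x * (\<Prod>h\<in>insert h S. \<rho> g (w h) - \<rho> h (w h))) =
       (\<Sum>g\<in>G. \<rho> g r * \<rho> g (x * w h) * (\<Prod>h\<in>S. \<rho> g (w h) - \<rho> h (w h)) -
             \<rho> h (w h) * (\<rho> g r * \<rho> g x * (\<Prod>h\<in>S. \<rho> g (w h) - \<rho> h (w h))))"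
    proof (rule sum.cong)
      fix g assume g: "g \<in> G"
      have "\<rho> g (x * w h) = \<rho> g x * \<rho> g (w h)"
        using galois_mult[OF \<rho>(1)[OF g] AQ AQ] insert.prems(2) h(2) by blast
      then show "\<rho> g r * \<rho> g x * (\<Prod>h\<in>insert h S. \<rho> g (w h) - \<rho> h (w h)) =
        \<rho> g r * \<rho> g (x * w h) * (\<Prod>h\<in>S. \<rho> g (w h) - \<rho> h (w h)) -
             \<rho> h (w h) * (\<rho> g r * \<rho> g x * (\<Prod>h\<in>S. \<rho> g (w h) - \<rho> h (w h)))"
        using insert.hyps by (simp add: algebra_simps)
    qed simp
    also have "\<dots> = of_int p * (y - \<rho> h (w h) * z)"
      by (simp only: sum_subtractf sum_distrib_left[symmetric] y z right_diff_distrib mult.left_commute)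
    finally show ?case
      by (intro bexI[of _ "y - \<rho> h (w h) * z"] OQ_diff[OF y(1) OQ_mult[OF OQ_galois[OF \<rho>(1)[OF h(1)] AO[OF h(2)]] z(1)]])
  qed
  define c where "c = (\<Prod>h\<in>G - {e}. w h - \<rho> h (w h))"
  have wO: "w h - \<rho> h (w h) \<in> OQ" if "h \<in> G - {e}" for h
  proof -
    have "h \<in> G" using that by blast
    then show ?thesis using OQ_diff[OF AO[OF w(1)[OF that]] OQ_galois[OF \<rho>(1) AO[OF w(1)[OF that]]]] by blast
  qed
  have cO: "c \<in> OQ" unfolding c_def by (rule OQ_prod[OF wO])
  obtain y where y: "y \<in> OQ"
    "(\<Sum>g\<in>G. \<rho> g r * \<rho> g 1 * (\<Prod>h\<in>G - {e}. \<rho> g (w h) - \<rho> h (w h))) = of_int p * y"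
    using step[of "G - {e}" 1] finG A1 by auto
  have "(\<Sum>g\<in>G. \<rho> g r * \<rho> g 1 * (\<Prod>h\<in>G - {e}. \<rho> g (w h) - \<rho> h (w h))) =
    \<rho> e r * \<rho> e 1 * (\<Prod>h\<in>G - {e}. \<rho> e (w h) - \<rho> h (w h)) +
    (\<Sum>g\<in>G - {e}. \<rho> g r * \<rho> g 1 * (\<Prod>h\<in>G - {e}. \<rho> g (w h) - \<rho> h (w h)))"
    by (rule sum.remove[OF finG eG])
  also have "(\<Prod>h\<in>G - {e}. \<rho> e (w h) - \<rho> h (w h)) = c"
    unfolding c_def by (rule prod.cong) (auto simp: \<rho>e w(1))
  \<comment> \<open>For \<open>g \<noteq> e\<close> the factor with \<open>h = g\<close>
    vanishes.\<close>
  also have "(\<Sum>g\<in>G - {e}. \<rho> g r * \<rho> g 1 * (\<Prod>h\<in>G - {e}. \<rho> g (w h) - \<rho> h (w h))) = 0"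
    using finG by (intro sum.neutral ballI) (auto intro!: prod_zero)
  finally have rc: "r * c = of_int p * y" using y(2) by (simp add: \<rho>e rA A1)
  \<comment> \<open>Squaring \<open>r c = p y\<close> and cancelling one \<open>p\<close> leaves
    \<open>u c^2 = p y^2\<close>, which lies in \<open>M\<close>.\<close>
  have "of_int p * (of_int u * c ^ 2) = r ^ 2 * c ^ 2" unfolding r(2) by (simp add: mult.assoc)
  also have "\<dots> = of_int p * (of_int p * y ^ 2)"
    unfolding power_mult_distrib[symmetric] rc by (simp add: power2_eq_square ac_simps)
  finally have "of_int u * c ^ 2 = of_int p * y ^ 2" using p by (auto simp: prime_gt_0_int)
  also have "\<dots> \<in> M" using pM y(1) by (auto simp: power2_eq_square intro!: M_mult OQ_mult)
  finally have "of_int u \<in> M \<or> c ^ 2 \<in> M"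
    using prime[OF OQ_of_int] cO by (auto simp: power2_eq_square intro!: OQ_mult)
  then have "c \<in> M" using r(3) M_of_int M_square[OF cO] by blast
  then obtain h where "h \<in> G - {e}" "w h - \<rho> h (w h) \<in> M"
    using M_prod[of "G - {e}" "\<lambda>h. w h - \<rho> h (w h)"] wO finG unfolding c_def by auto
  then show False using w(2)[of h] M_diff[OF M_0, of "w h - \<rho> h (w h)"] by simp
qed

end

section \<open>Levels of the tree and the critical orbit\<close>

text \<open>The homogenised map: \<open>phi (a / d)\<close> is the quotient of the components of \<open>hom_step (a, d)\<close>.\<close>

definition hom_step :: "int \<times> int \<Rightarrow> int \<times> int" where
  "hom_step = (\<lambda>(a, d). (a ^ 3 + 7 * a ^ 2 * d - 7 * d ^ 3, d ^ 3))"

text \<open>The critical point \<open>-14/3\<close> has value \<open>1183/27\<close>; this is the numerator of its orbit.\<close>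

definition crit_num :: "nat \<Rightarrow> int" where
  "crit_num n = fst ((hom_step ^^ n) (1183, 27))"

text \<open>Modulo 67 the critical value \<open>1183/27\<close> is mapped to the fixed point \<open>-1\<close>, which makes \<open>7 * crit_num n\<close>
  a non-residue for all \<open>n \<ge> 1\<close>; it is a square for \<open>n = 0\<close>.\<close>

lemma crit_orbit_invariant:
  assumes "(hom_step ^^ Suc n) (1183, 27) = (a, d)"
  shows "0 < d \<and> d \<le> a \<and> 7 dvd a \<and> \<not> 49 dvd a \<and> \<not> 7 dvd d \<and>
    67 dvd a + d \<and> \<not> 67 dvd d \<and> (\<exists>w. d = 27 * w ^ 2)"
  using assms
proof (induction n arbitrary: a d)
  case 0
  have "a = 1183 ^ 3 + 7 * 1183 ^ 2 * 27 - 7 * 27 ^ 3" "d = 27 ^ 3" using 0 by (auto simp: hom_step_def)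
  moreover have "(27::int) ^ 3 = 27 * 27 ^ 2" by simp
  ultimately show ?case by (intro conjI exI[of _ 27]) simp_all
next
  case (Suc n)
  obtain b c where bc: "(hom_step ^^ Suc n) (1183, 27) = (b, c)" by force
  then have IH: "0 < c" "c \<le> b" "7 dvd b" "\<not> 49 dvd b" "\<not> 7 dvd c" "67 dvd b + c" "\<not> 67 dvd c"
    "\<exists>w. c = 27 * w ^ 2" using Suc.IH by auto
  have ad: "a = b ^ 3 + 7 * b ^ 2 * c - 7 * c ^ 3" "d = c ^ 3"
    using Suc.prems bc by (auto simp: hom_step_def)
  have p7: "prime (7::int)" and p67: "prime (67::int)" by simp_all
  have d0: "0 < d" using IH(1) by (simp add: ad)
  \<comment> \<open>From \<open>c \<le> b\<close> the new numerator is at least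
    \<open>c^3 + 7 c^3 - 7 c^3\<close>. The invariant \<open>d \<le> a\<close> serves
    positivity.\<close>
  have "c ^ 3 \<le> b ^ 3" "c ^ 2 \<le> b ^ 2" using IH by (auto intro!: power_mono)
  moreover have "c ^ 2 * c \<le> b ^ 2 * c" using calculation(2) IH(1) by (intro mult_right_mono) auto
  ultimately have "d \<le> a" by (simp add: ad power3_eq_cube power2_eq_square)
  moreover have d7: "\<not> 7 dvd d" unfolding ad using IH(5) prime_dvd_power[OF p7] by blast
  moreover have d67: "\<not> 67 dvd d" unfolding ad using IH(7) prime_dvd_power[OF p67] by blast
  \<comment> \<open>That 7 divides \<open>a\<close> exactly once is what later excludes
    \<open>p = 7\<close>.\<close>
  moreover have "7 dvd a \<and> \<not> 49 dvd a"
  proof -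
    obtain k where k: "b = 7 * k" using IH(3) by (auto elim: dvdE)
    have a: "a = 7 * (7 * (7 * k ^ 3 + 7 * k ^ 2 * c) - d)"
      unfolding ad k by (simp add: power3_eq_cube power2_eq_square algebra_simps)
    moreover have "\<not> 49 dvd a"
    proof
      assume "49 dvd a"
      then obtain l where "a = 49 * l" by (auto elim: dvdE)
      then have "d = 7 * (7 * k ^ 3 + 7 * k ^ 2 * c - l)" using a by (simp add: algebra_simps)
      then show False using d7 by (metis dvd_triv_left)
    qed
    ultimately show ?thesis by simp
  qed
  moreover have "67 dvd a + d"
  proof -
    \<comment> \<open>The homogenised form of
      \<open>phi x + 1 = (x + 1) (x^2 + 6 x - 6)\<close>.\<close>
    have "a + d = (b + c) * (b ^ 2 + 6 * b * c - 6 * c ^ 2)"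
      unfolding ad by (simp add: power3_eq_cube power2_eq_square algebra_simps)
    then show ?thesis using IH(6) by simp
  qed
  \<comment> \<open>The denominators are odd powers of 27. As \<open>a\<close> is congruent to
    \<open>-d\<close> modulo 67, this fixes the quadratic character of \<open>7 a\<close>.\<close>
  moreover have "\<exists>w. d = 27 * w ^ 2"
  proof -
    obtain w where "c = 27 * w ^ 2" using IH(8) by blast
    then have "d = 27 * (27 * w ^ 3) ^ 2" unfolding ad by (simp add: power3_eq_cube power2_eq_square)
    then show ?thesis by blast
  qed
  ultimately show ?case using d0 by blast
qed

lemma crit_num_pos: "crit_num n > 0"
proof (cases n)
  case (Suc k)
  obtain a d where ad: "(hom_step ^^ n) (1183, 27) = (a, d)" by force
  then show ?thesis using crit_orbit_invariant[of k a d] Suc by (auto simp: crit_num_def)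
qed (simp add: crit_num_def)

text \<open>For \<open>w\<close> invertible modulo 67 the quotient \<open>y / w\<close> would be a
  square root of 12; all 67 residues are tested.\<close>

lemma twelve_nonresidue_67:
  fixes y w :: int
  assumes "67 dvd y ^ 2 - 12 * w ^ 2"
  shows "67 dvd w"
proof (rule ccontr)
  assume nw: "\<not> 67 dvd w"
  have p: "prime (67::int)" by simp
  then have "coprime w 67" using nw by (metis coprime_commute prime_imp_coprime)
  then obtain v t where vt: "v * w + t * 67 = 1"
    by (metis bezout_int coprime_imp_gcd_eq_1)
  define r where "r = (y * v) mod 67"
  have wv: "v * w = 1 - 67 * t" using vt by simp
  have "(y * v) ^ 2 - 12 = (y ^ 2 - 12 * w ^ 2) * v ^ 2 + 12 * ((v * w) ^ 2 - 1)"
    by (simp add: algebra_simps power_mult_distrib)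
  also have "12 * ((v * w) ^ 2 - 1) = 67 * (12 * (67 * t ^ 2 - 2 * t))"
    unfolding wv by (simp add: algebra_simps power2_eq_square)
  finally have "67 dvd (y * v) ^ 2 - 12" using assms by simp
  then have "(y * v) ^ 2 mod 67 = 12 mod 67" by (simp only: mod_eq_dvd_iff)
  then have r2: "r ^ 2 mod 67 = 12" by (simp add: r_def power_mod)
  have "r \<in> {0..66}" by (auto simp: r_def)
  also have "{0..66} = set [0..66::int]" by simp
  finally have "r \<in> set [0..66::int]" .
  moreover have "\<forall>r\<in>set [0..66::int]. r ^ 2 mod 67 \<noteq> 12" by code_simp
  ultimately show False using r2 by blast
qed

text \<open>By \<open>prod_level_plus_7\<close> and \<open>prod_level_crit\<close>,
  \<open>7 * crit_num n\<close> is the product of the discriminants over level \<open>n\<close>. A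
  positive integer that is not a square has a prime of odd multiplicity.\<close>

lemma odd_prime_in_discriminant:
  assumes "n \<ge> 1"
  obtains p k u where "prime p" "p \<noteq> 7" "7 * crit_num n = p ^ (2 * k + 1) * u" "\<not> p dvd u"
proof -
  obtain m where m: "n = Suc m" using assms by (cases n) auto
  obtain a d where ad: "(hom_step ^^ n) (1183, 27) = (a, d)" by force
  from crit_orbit_invariant[of m a d] ad m have inv: "0 < d" "d \<le> a" "7 dvd a" "\<not> 49 dvd a"
    "67 dvd a + d" "\<not> 67 dvd d" "\<exists>w. d = 27 * w ^ 2" by auto
  have cn: "crit_num n = a" by (simp add: crit_num_def ad)
  define x where "x = 7 * a"
  have x0: "x > 0" using inv by (simp add: x_def)
  have "\<not> is_nth_power 2 x"
  proof
    assume "is_nth_power 2 x"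
    then obtain y where y: "x = y ^ 2" by (auto simp: is_nth_power_def)
    obtain w where w: "d = 27 * w ^ 2" using inv by blast
    obtain k where k: "a + d = 67 * k" using inv(5) by (auto elim: dvdE)
    \<comment> \<open>\<open>y^2 = 7 a\<close> is congruent to \<open>-7 d = -189 w^2\<close> modulo
      67, and \<open>-189 - 12 = -201\<close> is a multiple of 67.\<close>
    have "y ^ 2 - 12 * w ^ 2 = 7 * (67 * k) - 201 * w ^ 2" using y k w by (simp add: x_def)
    also have "\<dots> = 67 * (7 * k - 3 * w ^ 2)" by simp
    finally have "67 dvd y ^ 2 - 12 * w ^ 2" by (metis dvd_triv_left)
    then have "67 dvd w" by (rule twelve_nonresidue_67)
    then show False using inv(6) w by (simp add: power2_eq_square)
  qed
  then obtain p where p: "prime p" "odd (multiplicity p x)"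
    using is_nth_power_conv_multiplicity[of 2 x] x0 by auto
  obtain u where u: "x = p ^ multiplicity p x * u" "\<not> p dvd u" 
  proof (rule multiplicity_decompose'[of x p])
    show "x \<noteq> 0" "\<not> is_unit p" using x0 p(1) not_prime_unit by auto
  qed
  have "p \<noteq> 7"
  proof
    assume p7: "p = 7"
    obtain b where b: "a = 7 * b" using inv by (auto elim: dvdE)
    have "\<not> 7 * 7 dvd 7 * b" using inv(4) b by simp
    then have b7: "\<not> 7 dvd b" by (simp only: dvd_mult_cancel_left) simp
    \<comment> \<open>One factor 7 is explicit and \<open>a\<close> contributes exactly one, so the
      multiplicity of 7 is even.\<close>
    have x: "x = 7 ^ 2 * b" by (simp add: x_def b)
    have "\<not> 7 ^ 2 * 7 dvd 7 ^ 2 * b" using b7 by (simp only: dvd_mult_cancel_left) simp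
    then have "multiplicity 7 x = 2" by (intro multiplicity_eqI) (simp_all add: x)
    then have "multiplicity p x = 2" by (simp add: p7)
    then show False using p(2) by simp
  qed
  obtain k where "multiplicity p x = 2 * k + 1" using p(2) by (rule oddE)
  then show ?thesis using that[of p k u] p(1) \<open>p \<noteq> 7\<close> u by (simp add: cn x_def)
qed

section \<open>Levels, fibres and norms\<close>

definition level :: "nat \<Rightarrow> complex set" where
  "level n = {z. (phi ^^ n) z = 0}"

lemma level_0: "level 0 = {0}"
  by (auto simp: level_def)

lemma level_Suc: "x \<in> level (Suc n) \<longleftrightarrow> phi x \<in> level n"
  by (simp add: level_def funpow_swap1)

lemma phi_iter_m7: "(phi ^^ n) (-7) = -7"
  by (induction n) (simp_all add: phi_def)

lemma phi_iter_0: "n \<ge> 1 \<Longrightarrow> (phi ^^ n) 0 = -7"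
proof (induction n rule: dec_induct)
  case (step n)
  then show ?case by (simp add: phi_def)
qed (simp add: phi_def)

lemma phi_iter_hom_step:
  assumes "of_int d * z = (of_int a :: complex)" "(hom_step ^^ n) (a, d) = (a', d')"
  shows "of_int d' * (phi ^^ n) z = of_int a'"
  using assms(2)
proof (induction n arbitrary: a' d')
  case 0
  then show ?case using assms(1) by simp
next
  case (Suc n)
  obtain b c where bc: "(hom_step ^^ n) (a, d) = (b, c)" by force
  define y where "y = (phi ^^ n) z"
  have y: "of_int c * y = of_int b" using Suc.IH[OF bc] by (simp add: y_def)
  have ad: "a' = b ^ 3 + 7 * b ^ 2 * c - 7 * c ^ 3" "d' = c ^ 3"
    using Suc.prems bc by (auto simp: hom_step_def)
  have "of_int d' * phi y = (of_int c * y) ^ 3 + 7 * (of_int c * y) ^ 2 * of_int c - 7 * of_int c ^ 3"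
    by (simp add: ad phi_def algebra_simps power3_eq_cube power2_eq_square)
  also have "\<dots> = of_int a'" unfolding y by (simp add: ad)
  finally show ?case by (simp add: y_def)
qed

text \<open>The two factors vanish at the critical values \<open>phi 0 = -7\<close> and
  \<open>phi (-14/3) = 1183/27\<close>. The first is a fixed point and the orbit of the second has
  positive numerators, so neither orbit reaches 0.\<close>

lemma level_not_critical:
  assumes "al \<in> level n"
  shows "al + 7 \<noteq> 0" "1183 - 27 * al \<noteq> 0"
proof -
  show "al + 7 \<noteq> 0" using assms phi_iter_m7[of n] by (auto simp: level_def add_eq_0_iff2)
  show "1183 - 27 * al \<noteq> 0"
  proof
    assume "1183 - 27 * al = 0"
    then have "of_int 27 * al = of_int 1183" by simp
    moreover obtain a d where ad: "(hom_step ^^ n) (1183, 27) = (a, d)" by force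
    ultimately have "of_int d * (phi ^^ n) al = of_int a" by (rule phi_iter_hom_step)
    then have "a = 0" using assms by (simp add: level_def)
    then show False using crit_num_pos[of n] ad by (simp add: crit_num_def)
  qed
qed

lemma cubic_discriminant:
  fixes a b c :: complex
  shows "((a - b) * (b - c) * (c - a)) ^ 2 =
    (a + b + c) ^ 2 * (a * b + b * c + c * a) ^ 2 - 4 * (a * b + b * c + c * a) ^ 3
    - 4 * (a + b + c) ^ 3 * (a * b * c) + 18 * (a + b + c) * (a * b + b * c + c * a) * (a * b * c)
    - 27 * (a * b * c) ^ 2"
  by algebra

lemma phi_discriminant:
  fixes a b c al :: complex
  assumes "a + b + c = -7" "a * b + b * c + c * a = 0" "a * b * c = al + 7"
  shows "((a - b) * (b - c) * (c - a)) ^ 2 = (al + 7) * (1183 - 27 * al)"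
  unfolding cubic_discriminant assms by (simp add: algebra_simps power2_eq_square)

lemma phi_factor:
  assumes "a + b + c = -7" "a * b + b * c + c * a = 0" "a * b * c = al + 7"
  shows "phi t - al = (t - a) * (t - b) * (t - c)"
proof -
  have "(t - a) * (t - b) * (t - c) = t ^ 3 - (a + b + c) * t ^ 2 + (a * b + b * c + c * a) * t - a * b * c"
    by algebra
  then show ?thesis unfolding assms by (simp add: phi_def)
qed

text \<open>The sum of the roots dictates \<open>z\<close>; cancelling \<open>x - y\<close> from
  \<open>phi x - phi y = 0\<close> gives the second relation, and the equation for \<open>x\<close>
  the third.\<close>

lemma vieta_of_pair:
  assumes "phi x = al" "phi y = al" "x \<noteq> y" "z = -7 - x - y"
  shows "x + y + z = -7" "x * y + y * z + z * x = 0" "x * y * z = al + 7"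
proof -
  show "x + y + z = -7" using assms by simp
  have "(x - y) * (x * y + y * z + z * x) = - (phi x - phi y)"
    unfolding phi_def assms(4) by (simp add: algebra_simps power2_eq_square power3_eq_cube)
  then show e2: "x * y + y * z + z * x = 0" using assms by simp
  have "x * y * z - (phi x + 7) = x * (x * y + y * z + z * x)"
    unfolding phi_def assms(4) by (simp add: algebra_simps power2_eq_square power3_eq_cube)
  then show "x * y * z = al + 7" using e2 assms(1) by simp
qed

lemma fibre_roots:
  fixes al :: complex
  shows "\<exists>a b c. a + b + c = -7 \<and> a * b + b * c + c * a = 0 \<and> a * b * c = al + 7"
proof -
  have "\<not> constant (poly [:-7 - al, 0, 7, 1:])" by (simp add: constant_degree)
  then obtain a where "poly [:-7 - al, 0, 7, 1:] a = 0" using fundamental_theorem_of_algebra by blast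
  then have a: "a * a * a + 7 * (a * a) = al + 7" by (simp add: algebra_simps)
  \<comment> \<open>Quadratic formula for the cofactor \<open>t^2 + (a + 7) t + a (a + 7)\<close> of
    \<open>t - a\<close>.\<close>
  define s where "s = csqrt ((a + 7) ^ 2 - 4 * (a * (a + 7)))"
  have s: "s * s = (a + 7) ^ 2 - 4 * (a * (a + 7))" unfolding s_def by (metis power2_csqrt power2_eq_square)
  define b c where "b = (- (a + 7) + s) / 2" and "c = (- (a + 7) - s) / 2"
  have bc: "b + c = - (a + 7)" by (simp add: b_def c_def field_simps)
  have "4 * (b * c) = (a + 7) ^ 2 - s * s" 
  proof -
    have b2: "2 * b = - (a + 7) + s" and c2: "2 * c = - (a + 7) - s" by (simp_all add: b_def c_def)
    have "4 * (b * c) = (2 * b) * (2 * c)" by simp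
    then show ?thesis unfolding b2 c2 by (simp add: algebra_simps power2_eq_square)
  qed
  then have bc': "b * c = a * (a + 7)" unfolding s by simp
  have "a * b + b * c + c * a = a * (b + c) + b * c" by (simp add: algebra_simps)
  also have "\<dots> = 0" unfolding bc bc' by (simp add: algebra_simps)
  finally have "a * b + b * c + c * a = 0" .
  moreover have "a + b + c = -7" using bc by (simp add: add.assoc)
  moreover have "a * b * c = al + 7" using bc' a by (simp add: algebra_simps)
  ultimately show ?thesis by blast
qed

lemma level_fibre:
  assumes "al \<in> level n"
  obtains a b c where "a \<noteq> b" "b \<noteq> c" "a \<noteq> c" "{x. phi x = al} = {a, b, c}"
    "a + b + c = -7" "a * b + b * c + c * a = 0" "a * b * c = al + 7"
proof -
  obtain a b c where v: "a + b + c = -7" "a * b + b * c + c * a = 0" "a * b * c = al + 7"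
    using fibre_roots by blast
  have "((a - b) * (b - c) * (c - a)) ^ 2 \<noteq> 0"
    unfolding phi_discriminant[OF v] using level_not_critical[OF assms] by simp
  then have "a \<noteq> b" "b \<noteq> c" "a \<noteq> c" by auto
  moreover have "phi x = al \<longleftrightarrow> x = a \<or> x = b \<or> x = c" for x
    using phi_factor[OF v, of x] by auto
  then have "{x. phi x = al} = {a, b, c}" by auto
  ultimately show ?thesis using that v by blast
qed

lemma level_Suc_Union: "level (Suc n) = (\<Union>al\<in>level n. {x. phi x = al})"
  by (auto simp: level_Suc)

lemma finite_level: "finite (level n)"
proof (induction n)
  case (Suc n)
  have "finite {x. phi x = al}" if "al \<in> level n" for al
    using that by (rule level_fibre) simp
  then show ?case unfolding level_Suc_Union using Suc by blast
qed (simp add: level_0)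

text \<open>Over one fibre the product is \<open>d^3 (phi (a / d) - al)\<close>, again a factor of
  the same shape, now for \<open>hom_step (a, d)\<close>; so one level is peeled off at a
  time.\<close>

lemma prod_level:
  "(\<Prod>x\<in>level n. of_int a - of_int d * x) = of_int (fst ((hom_step ^^ n) (a, d)))"
proof (induction n arbitrary: a d)
  case (Suc n)
  have fibre: "(\<Prod>x\<in>{x. phi x = al}. of_int a - of_int d * x) =
    of_int (a ^ 3 + 7 * a ^ 2 * d - 7 * d ^ 3) - of_int (d ^ 3) * al" if al: "al \<in> level n" for al
  proof -
    obtain u v w where uvw: "u \<noteq> v" "v \<noteq> w" "u \<noteq> w" "{x. phi x = al} = {u, v, w}"
      "u + v + w = -7" "u * v + v * w + w * u = 0" "u * v * w = al + 7"
      using level_fibre[OF al] .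
    define A D :: complex where "A = of_int a" and "D = of_int d"
    have "(\<Prod>x\<in>{x. phi x = al}. A - D * x) = (A - D * u) * (A - D * v) * (A - D * w)"
      unfolding uvw(4) using uvw(1-3) by (simp add: mult.assoc)
    also have "\<dots> = A ^ 3 - (u + v + w) * A ^ 2 * D + (u * v + v * w + w * u) * A * D ^ 2 - u * v * w * D ^ 3"
      by algebra
    also have "\<dots> = A ^ 3 + 7 * A ^ 2 * D - 7 * D ^ 3 - D ^ 3 * al"
      unfolding uvw by (simp add: algebra_simps)
    finally show ?thesis by (simp add: A_def D_def)
  qed
  have "(\<Prod>x\<in>level (Suc n). of_int a - of_int d * x) =
    (\<Prod>al\<in>level n. \<Prod>x\<in>{x. phi x = al}. of_int a - of_int d * x)"
    unfolding level_Suc_Union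
  proof (rule prod.UNION_disjoint)
    show "\<forall>al\<in>level n. finite {x. phi x = al}"
      by (metis finite.emptyI finite.insertI level_fibre)
  qed (auto simp: finite_level)
  also have "\<dots> = (\<Prod>al\<in>level n. of_int (a ^ 3 + 7 * a ^ 2 * d - 7 * d ^ 3) - of_int (d ^ 3) * al)"
    by (rule prod.cong[OF refl fibre])
  also have "\<dots> = of_int (fst ((hom_step ^^ n) (hom_step (a, d))))"
    unfolding Suc.IH by (simp add: hom_step_def)
  finally show ?case by (simp add: funpow_swap1)
qed (simp add: level_0)

lemma prod_level_crit: "(\<Prod>al\<in>level n. 1183 - 27 * al) = of_int (crit_num n)"
  using prod_level[where n = n and a = 1183 and d = 27] by (simp add: crit_num_def)

lemma prod_level_plus_7: "(\<Prod>al\<in>level n. al + 7) = 7"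
proof -
  \<comment> \<open>\<open>(7, -1)\<close> represents the fixed point -7.\<close>
  have "(hom_step ^^ n) (7, -1) = (7, -1)" by (induction n) (simp_all add: hom_step_def)
  then show ?thesis using prod_level[where n = n and a = 7 and d = "-1"] by (simp add: add.commute)
qed

lemma prod_level_7:
  assumes "n \<ge> 1"
  shows "(\<Prod>al\<in>level n. al) = 7"
proof -
  \<comment> \<open>\<open>(0, -1)\<close> represents 0, which reaches -7 after one step; hence
    \<open>n \<ge> 1\<close>.\<close>
  have "(hom_step ^^ n) (0, -1) = (7, -1)"
    using assms by (induction n rule: dec_induct) (simp_all add: hom_step_def)
  then show ?thesis using prod_level[where n = n and a = 0 and d = "-1"] by simp
qed

lemma level_algebraic_int: "x \<in> level n \<Longrightarrow> algebraic_int x"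
proof (induction n arbitrary: x)
  case (Suc n)
  then have "algebraic_int (phi x)" by (simp add: level_Suc)
  then show ?case
  proof (rule algebraic_int_root)
    show "poly [:-7, 0, 7, 1:] x = phi x" by (simp add: phi_def algebra_simps power2_eq_square power3_eq_cube)
  qed (auto simp: coeff_pCons split: nat.splits)
qed (simp add: level_0)

lemma level_OQ: "x \<in> level n \<Longrightarrow> x \<in> OQ"
  using level_algebraic_int OQ_algebraic_int by blast

lemma level_Qbar: "x \<in> level n \<Longrightarrow> x \<in> Qbar"
  using level_OQ OQ_Qbar by blast

lemma galois_phi: "s \<in> abs_galois \<Longrightarrow> x \<in> Qbar \<Longrightarrow> s (phi x) = phi (s x)"
  by (simp add: phi_def galois_add galois_diff galois_mult galois_power galois_maps_rat
      Qbar_add Qbar_mult Qbar_power Qbar_rat)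

lemma galois_level: "s \<in> abs_galois \<Longrightarrow> x \<in> level n \<Longrightarrow> s x \<in> level n"
proof (induction n arbitrary: x)
  case 0
  then show ?case using galois_maps_rat[of s 0] by (simp add: level_0)
next
  case (Suc n)
  then show ?case using galois_phi[OF Suc.prems(1) level_Qbar[OF Suc.prems(2)]] by (metis level_Suc)
qed

section \<open>Transitivity and transpositions\<close>

lemma OQ_numeral: "numeral k \<in> OQ"
  using OQ_of_int[of "numeral k"] by simp

lemma phi_OQ: "x \<in> OQ \<Longrightarrow> phi x \<in> OQ"
proof -
  assume x: "x \<in> OQ"
  have "phi x = x * x * x + of_int 7 * (x * x) - of_int 7"
    by (simp add: phi_def power2_eq_square power3_eq_cube)
  then show ?thesis using x by (auto intro!: OQ_add OQ_diff OQ_mult OQ_of_int simp del: of_int_numeral)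
qed

lemma phi_iter_OQ: "x \<in> OQ \<Longrightarrow> (phi ^^ n) x \<in> OQ"
  by (induction n) (auto intro: phi_OQ)

section \<open>Collisions of vertices modulo a prime\<close>

context prime_over
begin

lemma phi_cong:
  assumes "x \<in> OQ" "y \<in> OQ" "x - y \<in> M"
  shows "phi x - phi y \<in> M"
proof -
  have "phi x - phi y = (x - y) * (x * x + x * y + y * y + of_int 7 * (x + y))"
    by (simp add: phi_def algebra_simps power2_eq_square power3_eq_cube)
  then show ?thesis using assms by (auto intro!: M_mult OQ_add OQ_mult OQ_of_int simp del: of_int_numeral)
qed

lemma phi_iter_cong: "x \<in> OQ \<Longrightarrow> y \<in> OQ \<Longrightarrow> x - y \<in> M \<Longrightarrow> (phi ^^ n) x - (phi ^^ n) y \<in> M"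
  by (induction n) (auto intro: phi_cong phi_iter_OQ)

lemma M_numeral: "numeral k \<in> M \<longleftrightarrow> p dvd numeral k"
  using M_of_int[of "numeral k"] by simp

lemma seven_notin:
  assumes "p \<noteq> 7"
  shows "7 \<notin> M"
proof
  assume "7 \<in> M"
  then have "p dvd 7" using M_numeral by blast
  then show False using assms primes_dvd_imp_eq[OF p] by force
qed

text \<open>Iterating a congruence with the fixed point -7 would make 0 congruent to -7.\<close>

lemma level_plus_7_notin:
  assumes "p \<noteq> 7" "al \<in> level n"
  shows "al + 7 \<notin> M"
proof
  assume "al + 7 \<in> M"
  then have "al - of_int (-7) \<in> M" by simp
  from phi_iter_cong[OF level_OQ[OF assms(2)] OQ_of_int this, of n]
  have "7 \<in> M" using assms(2) phi_iter_m7[of n] by (simp add: level_def)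
  then show False using seven_notin assms by blast
qed

lemma cong_of_crit:
  assumes "al \<in> OQ" "be \<in> OQ" "1183 - 27 * al \<in> M" "1183 - 27 * be \<in> M"
  shows "al - be \<in> M"
proof -
  have "27 * (al - be) \<in> M" using M_diff[OF assms(4,3)] by (simp add: algebra_simps)
  then have "27 \<in> M \<or> al - be \<in> M" using prime OQ_numeral OQ_diff assms(1,2) by blast
  moreover have "27 \<notin> M"
  proof
    assume 27: "27 \<in> M"
    have "1183 - 27 * al + 27 * al \<in> M" using assms by (intro M_add M_mult[OF 27])
    then have "1183 \<in> M" by simp
    then have d: "p dvd 1183" "p dvd 27" using 27 M_numeral by blast+
    \<comment> \<open>A Bezout relation: this combination equals 1.\<close>
    have "p dvd 1183 * 16 - 27 * 701" by (rule dvd_diff[OF dvd_mult2[OF d(1)] dvd_mult2[OF d(2)]])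
    then have "is_unit p" by simp
    then show False using p not_prime_unit by blast
  qed
  ultimately show ?thesis by blast
qed

text \<open>Both vertices are congruent to \<open>1183 / 27\<close>, hence to each other. After
  \<open>j\<close> steps \<open>al\<close> is at 0, and the remaining \<open>n - j \<ge> 1\<close>
  steps take 0 to -7 but the image of \<open>be\<close> to 0, so 7 would lie in
  \<open>M\<close>.\<close>

lemma crit_levels_disjoint:
  assumes "p \<noteq> 7" "al \<in> level j" "be \<in> level n" "j < n" "1183 - 27 * al \<in> M" "1183 - 27 * be \<in> M"
  shows False
proof -
  have O: "al \<in> OQ" "be \<in> OQ" using assms level_OQ by blast+
  have "be - al \<in> M" using cong_of_crit[OF O(2,1) assms(6,5)] .
  from phi_iter_cong[OF O(2,1) this, of j] have "(phi ^^ j) be - 0 \<in> M"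
    using assms(2) by (simp add: level_def)
  from phi_iter_cong[OF phi_iter_OQ[OF O(2)] OQ_0 this, of "n - j"]
  have "(phi ^^ (n - j)) ((phi ^^ j) be) - (phi ^^ (n - j)) 0 \<in> M" .
  moreover have "(phi ^^ (n - j)) ((phi ^^ j) be) = (phi ^^ n) be"
    using assms(4) by (metis comp_apply funpow_add le_add_diff_inverse2 less_imp_le)
  moreover have "(phi ^^ (n - j)) 0 = -7" using assms(4) by (intro phi_iter_0) simp
  ultimately have "7 \<in> M" using assms(3) by (simp add: level_def)
  then show False using seven_notin assms(1) by blast
qed

text \<open>\<open>x - y\<close> divides a square root of the discriminant
  \<open>(phi x + 7) (1183 - 27 phi x)\<close>, whose first factor is outside
  \<open>M\<close>.\<close>

lemma cong_in_fibre_imp_crit: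
  assumes "p \<noteq> 7" "x \<in> level (Suc j)" "y \<in> level (Suc j)" "x \<noteq> y" "phi x = phi y" "x - y \<in> M"
  shows "1183 - 27 * phi x \<in> M"
proof -
  define z where "z = -7 - x - y"
  have O: "x \<in> OQ" "y \<in> OQ" using assms level_OQ by blast+
  have zO: "z \<in> OQ" unfolding z_def using O OQ_of_int[of "-7"] by (auto intro!: OQ_diff)
  have phiO: "phi x \<in> OQ" using phi_OQ O by blast
  have "(x - y) * ((y - z) * (z - x)) \<in> M" using O zO assms by (intro M_mult OQ_mult OQ_diff) auto
  from M_mult[OF this M_OQ[OF this]]
  have "((x - y) * (y - z) * (z - x)) * ((x - y) * (y - z) * (z - x)) \<in> M"
    by (simp add: mult.assoc)
  also have "((x - y) * (y - z) * (z - x)) * ((x - y) * (y - z) * (z - x)) = (phi x + 7) * (1183 - 27 * phi x)"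
    using phi_discriminant[OF vieta_of_pair[OF refl assms(5)[symmetric] assms(4) z_def]]
    by (simp only: power2_eq_square)
  finally have "phi x + 7 \<in> M \<or> 1183 - 27 * phi x \<in> M"
    using phiO by (intro prime) (auto intro!: OQ_add OQ_diff OQ_mult OQ_numeral)
  moreover have "phi x \<in> level j" using assms(2) by (simp add: level_Suc)
  ultimately show ?thesis using level_plus_7_notin assms(1) by blast
qed

text \<open>By induction a collision takes place within one fibre, over a vertex of a level below
  \<open>n\<close> that meets the critical value modulo \<open>M\<close>; but \<open>be\<close> on
  level \<open>n\<close> already does.\<close>

lemma level_cong_imp_eq:
  assumes p7: "p \<noteq> 7" and be: "be \<in> level n" "1183 - 27 * be \<in> M"
  shows "j \<le> n \<Longrightarrow> x \<in> level j \<Longrightarrow> y \<in> level j \<Longrightarrow> x - y \<in> M \<Longrightarrow> x = y"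
proof (induction j arbitrary: x y)
  case (Suc j)
  have O: "x \<in> OQ" "y \<in> OQ" using Suc.prems level_OQ by blast+
  have "phi x - phi y \<in> M" using phi_cong O Suc.prems by blast
  then have eq: "phi x = phi y" using Suc by (simp add: level_Suc)
  show ?case
  proof (rule ccontr)
    assume "x \<noteq> y"
    then have "1183 - 27 * phi x \<in> M" using cong_in_fibre_imp_crit p7 Suc.prems eq by blast
    moreover have "phi x \<in> level j" "j < n" using Suc.prems by (auto simp: level_Suc)
    ultimately show False using crit_levels_disjoint p7 be by blast
  qed
qed (simp add: level_0)

text \<open>A triple root modulo \<open>M\<close> would satisfy \<open>3 x^2 = 0\<close> and
  \<open>3 x + 7 = 0\<close> there, by comparing coefficients, and hence
  \<open>49 = 0\<close>.\<close>

lemma third_not_cong: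
  assumes "p \<noteq> 7" "x \<in> OQ" "y \<in> OQ" "x \<noteq> y" "phi x = phi y" "x - y \<in> M" "z = -7 - x - y"
  shows "z - x \<notin> M"
proof
  assume zx: "z - x \<in> M"
  have zO: "z \<in> OQ" unfolding assms(7) using assms(2,3) OQ_of_int[of "-7"] by (auto intro!: OQ_diff)
  have e2: "x * y + y * z + z * x = 0" by (rule vieta_of_pair(2)[OF refl assms(5)[symmetric] assms(4,7)])
  have "3 * (3 * (x * x)) = 3 * (3 * (x * x) - (x * y + y * z + z * x))" unfolding e2 by simp
  also have "\<dots> = 3 * ((x - y) * x + ((x - y) * z - (z - x) * x) - (z - x) * x)" by (simp add: algebra_simps)
  also have "\<dots> \<in> M"
    by (intro M_mult'[OF OQ_numeral] M_diff[OF M_add[OF _ M_diff]] M_mult[OF zx] M_mult[OF assms(6)] assms(2) zO)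
  finally have 1: "9 * (x * x) \<in> M" by simp
  have eq: "3 * x + 7 = (x - y) - (z - x)" unfolding assms(7) by simp
  have "3 * x + 7 \<in> M" unfolding eq by (rule M_diff[OF assms(6) zx])
  then have "(3 * x + 7) * (7 - 3 * x) + 9 * (x * x) \<in> M"
    by (intro M_add[OF M_mult 1] OQ_diff OQ_mult OQ_numeral assms(2))
  also have "(3 * x + 7) * (7 - 3 * x) + 9 * (x * x) = 7 ^ 2" by (simp add: algebra_simps)
  finally show False using seven_notin[OF assms(1)] M_square[OF OQ_numeral] by blast
qed

text \<open>Since level \<open>n\<close> is separated modulo \<open>M\<close>, \<open>s\<close>
  fixes it pointwise and preserves fibres. A moved point collides with its image, so it lies over a
  critical vertex, which must be \<open>be\<close>. There the third point is congruent to neither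
  \<open>x\<close> nor \<open>y\<close> and stays fixed.\<close>

lemma inertia_is_transposition:
  assumes p7: "p \<noteq> 7" and be: "be \<in> level n" "1183 - 27 * be \<in> M"
    and s: "s \<in> abs_galois" "\<And>w. w \<in> level (Suc n) \<Longrightarrow> s w - w \<in> M"
    and x: "x \<in> level (Suc n)" "s x \<noteq> x"
  shows "\<exists>y z. {x, y, z} \<subseteq> level (Suc n) \<and> distinct [x, y, z] \<and> phi y = phi x \<and> phi z = phi x \<and>
     s x = y \<and> s y = x \<and> (\<forall>w\<in>level (Suc n) - {x, y}. s w = w)"
proof -
  have moved: "phi w = be \<and> phi (s w) = be" if w: "w \<in> level (Suc n)" "s w \<noteq> w" for w
  proof -
    have sw: "s w \<in> level (Suc n)" using galois_level s(1) w(1) by blast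
    have O: "w \<in> OQ" "s w \<in> OQ" using w sw level_OQ by blast+
    have c: "s w - w \<in> M" using s(2) w(1) by blast
    have "phi (s w) - phi w \<in> M" using phi_cong[OF O(2,1) c] .
    then have eq: "phi (s w) = phi w"
      using level_cong_imp_eq[OF p7 be, of n "phi (s w)" "phi w"] w sw by (auto simp: level_Suc)
    then have "1183 - 27 * phi (s w) \<in> M" using cong_in_fibre_imp_crit[OF p7 sw w(1) w(2) eq c] by blast
    then have "phi (s w) - be \<in> M" using cong_of_crit phi_OQ O level_OQ be by blast
    then have "phi (s w) = be"
      using level_cong_imp_eq[OF p7 be, of n "phi (s w)" be] sw be by (auto simp: level_Suc)
    then show ?thesis using eq by simp
  qed
  define y where "y = s x"
  define z where "z = -7 - x - y"
  have y: "y \<in> level (Suc n)" using galois_level s(1) x(1) unfolding y_def by blast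
  have O: "x \<in> OQ" "y \<in> OQ" using x y level_OQ by blast+
  have phi: "phi x = be" "phi y = be" using moved x unfolding y_def by blast+
  have c: "y - x \<in> M" using s(2) x(1) unfolding y_def by blast
  then have c': "x - y \<in> M" using M_diff[OF M_0 c] by simp
  have xy: "x \<noteq> y" using x(2) unfolding y_def by simp
  note v = vieta_of_pair[OF phi xy z_def]
  have zx: "z - x \<notin> M"
    using third_not_cong[OF p7 O xy _ c' z_def] phi by simp
  have zy: "z - y \<notin> M"
    using third_not_cong[OF p7 O(2,1) _ _ c, of z] phi xy z_def by simp
  have fib: "phi w = be \<longleftrightarrow> w = x \<or> w = y \<or> w = z" for w
    using phi_factor[OF v, of w] by auto
  have z: "z \<in> level (Suc n)" using fib[of z] be(1) by (simp add: level_Suc)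
  have zne: "z \<noteq> x" "z \<noteq> y" using zx zy M_0 by auto
  have sz: "s z = z"
  proof (rule ccontr)
    assume nz: "s z \<noteq> z"
    have "s z - z \<in> M" using s(2) z by blast
    then have zs: "z - s z \<in> M" using M_diff[OF M_0, of "s z - z"] by simp
    have "s z = x \<or> s z = y" using moved[OF z nz] fib[of "s z"] nz by blast
    then show False using zs zx zy by auto
  qed
  have inj: "s u = s w \<longleftrightarrow> u = w" if "u \<in> level (Suc n)" "w \<in> level (Suc n)" for u w
    using galois_inj[OF s(1)] level_Qbar that by blast
  have "phi (s y) = be"
    using galois_phi[OF s(1) level_Qbar[OF y]] galois_phi[OF s(1) level_Qbar[OF x(1)]] phi y_def by simp
  then have "s y = x \<or> s y = y \<or> s y = z" using fib by blast
  moreover have "s y \<noteq> y" using inj[OF y x(1)] xy y_def by auto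
  moreover have "s y \<noteq> z" using inj[OF y z] sz zne by auto
  ultimately have sy: "s y = x" by blast
  have "s w = w" if w: "w \<in> level (Suc n) - {x, y}" for w
  proof (rule ccontr)
    assume nw: "s w \<noteq> w"
    then have "phi w = be" using moved w by blast
    then have "w = z" using fib w by blast
    then show False using sz nw by simp
  qed
  moreover have "phi z = be" using fib by blast
  ultimately show ?thesis using x(1) y z xy zne sy phi
    by (intro exI[of _ y] exI[of _ z]) (auto simp: y_def)
qed

text \<open>Modulo 7 the map \<open>phi\<close> is the cube, so primality of \<open>M\<close> pulls
  membership back from \<open>phi x\<close> to \<open>x\<close>. This is the Eisenstein property in
  the form used for transitivity.\<close>

lemma level_in_M:
  assumes "p = 7" "x \<in> level n"
  shows "x \<in> M"
  using assms(2)
proof (induction n arbitrary: x)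
  case (Suc n)
  have O: "x \<in> OQ" using Suc.prems level_OQ by blast
  have 7: "7 \<in> M" using pM assms(1) by simp
  have "phi x + 7 - 7 * (x * x) \<in> M"
    using Suc O 7 by (intro M_diff M_add M_mult OQ_mult) (auto simp: level_Suc)
  also have "phi x + 7 - 7 * (x * x) = x ^ 2 * x" by (simp add: phi_def power2_eq_square power3_eq_cube)
  finally have "x ^ 2 \<in> M \<or> x \<in> M" using O by (intro prime) (auto simp: power2_eq_square intro: OQ_mult)
  then show ?case using M_square[OF O] by blast
qed (simp add: level_0 M_0)

end

text \<open>A proper orbit and its complement would both have product divisible by 7, as every vertex lies
  in a prime over 7; but the product over the whole level is 7.\<close>

lemma galois_transitive:
  assumes x: "x \<in> level n" and y: "y \<in> level n"
  shows "\<exists>s\<in>abs_galois. s x = y"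
proof (cases "n = 0")
  case True
  then show ?thesis using assms by (intro bexI[of _ id] galois_id) (auto simp: level_0)
next
  case False
  have "prime (7::int)" by simp
  then obtain M where "prime_over 7 M" using prime_over_ex by blast
  then interpret prime_over 7 M .
  define Or where "Or = (\<lambda>s. s x) ` abs_galois"
  have OrL: "Or \<subseteq> level n" using galois_level x by (auto simp: Or_def)
  have finOr: "finite Or" using OrL finite_level finite_subset by blast
  have stab: "s ` Or = Or" if s: "s \<in> abs_galois" for s
  proof (rule endo_inj_surj[OF finOr])
    show "s ` Or \<subseteq> Or"
    proof
      fix w assume "w \<in> s ` Or"
      then obtain t where t: "t \<in> abs_galois" "w = s (t x)" by (auto simp: Or_def)
      then have "w = (s \<circ> t) x" by simp
      then show "w \<in> Or" unfolding Or_def using galois_comp[OF s t(1)] by blast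
    qed
    show "inj_on s Or" using galois_inj[OF s] OrL level_Qbar by (intro inj_onI) blast
  qed
  have stab': "s ` level n = level n" if s: "s \<in> abs_galois" for s
  proof (rule endo_inj_surj[OF finite_level])
    show "s ` level n \<subseteq> level n" using galois_level[OF s] by blast
    show "inj_on s (level n)" using galois_inj[OF s] level_Qbar by (intro inj_onI) blast
  qed
  have prod7: "\<exists>k. (\<Prod>z\<in>S. z) = of_int (7 * k)"
    if S: "S \<subseteq> level n" "S \<noteq> {}" "\<And>s. s \<in> abs_galois \<Longrightarrow> s ` S = S" for S
  proof -
    have finS: "finite S" using S(1) finite_level finite_subset by blast
    have SO: "z \<in> OQ" if "z \<in> S" for z using S(1) that level_OQ by blast
    have "(\<Prod>z\<in>S. z) \<in> OQ" by (rule OQ_prod[OF SO])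
    moreover have "s (\<Prod>z\<in>S. z) = (\<Prod>z\<in>S. z)" if s: "s \<in> abs_galois" for s
    proof -
      have inj: "inj_on s S" using galois_inj[OF s] SO OQ_Qbar by (intro inj_onI) blast
      have "s (\<Prod>z\<in>S. z) = (\<Prod>z\<in>S. s z)" by (rule galois_prod[OF s OQ_Qbar[OF SO]])
      also have "\<dots> = (\<Prod>z\<in>s ` S. z)" by (simp add: prod.reindex[OF inj])
      finally show ?thesis using S(3)[OF s] by simp
    qed
    ultimately obtain k where k: "(\<Prod>z\<in>S. z) = of_int k" using OQ_fixed by blast
    obtain z where z: "z \<in> S" using S(2) by blast
    have "z * (\<Prod>z\<in>S - {z}. z) \<in> M"
      using level_in_M[OF refl] S(1) z SO by (intro M_mult OQ_prod) auto
    then have "(\<Prod>z\<in>S. z) \<in> M" using prod.remove[OF finS z, of "\<lambda>z. z"] by simp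
    then have "7 dvd k" unfolding k M_of_int .
    then show ?thesis using k by (auto elim: dvdE)
  qed
  have "y \<in> Or"
  proof (rule ccontr)
    assume ny: "y \<notin> Or"
    have "Or \<noteq> {}" using galois_id by (auto simp: Or_def)
    then obtain k where k: "(\<Prod>z\<in>Or. z) = of_int (7 * k)" using prod7[OF OrL] stab by blast
    have "s ` (level n - Or) = level n - Or" if s: "s \<in> abs_galois" for s
    proof -
      have "inj_on s (level n)" using galois_inj[OF s] level_Qbar by (intro inj_onI) blast
      then show ?thesis using inj_on_image_set_diff[of s "level n" "level n" Or] OrL stab[OF s] stab'[OF s]
        by auto
    qed
    then obtain l where l: "(\<Prod>z\<in>level n - Or. z) = of_int (7 * l)"
      using prod7[of "level n - Or"] y ny by blast
    have "(\<Prod>z\<in>level n. z) = of_int (7 * l) * of_int (7 * k)"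
      using prod.subset_diff[OF OrL finite_level, of "\<lambda>z. z"] k l by simp
    then have "of_int (7 * l * (7 * k)) = (of_int 7 :: complex)" using prod_level_7[of n] False by simp
    then have "7 * l * (7 * k) = 7" by (simp only: of_int_eq_iff)
    then have "7 * (7 * (l * k)) = 7" by (simp only: ac_simps)
    then show False by presburger
  qed
  then show ?thesis by (auto simp: Or_def)
qed

lemma galois_transposition_ex:
  assumes "n \<ge> 1"
  shows "\<exists>x y z. \<exists>s\<in>abs_galois. {x, y, z} \<subseteq> level (Suc n) \<and> distinct [x, y, z] \<and> phi y = phi x \<and>
     phi z = phi x \<and> s x = y \<and> s y = x \<and> (\<forall>w\<in>level (Suc n) - {x, y}. s w = w)"
proof -
  obtain p k u where pku: "prime p" "p \<noteq> 7" "7 * crit_num n = p ^ (2 * k + 1) * u" "\<not> p dvd u"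
    using odd_prime_in_discriminant[OF assms] .
  obtain M where "prime_over p M" using prime_over_ex pku(1) by blast
  then interpret prime_over p M .
  have "p dvd 7 * crit_num n" unfolding pku(3) by simp
  moreover have "\<not> p dvd 7" using pku(2) primes_dvd_imp_eq[OF pku(1), of 7] by auto
  ultimately have "p dvd crit_num n" using pku(1) prime_dvd_mult_iff by blast
  then have "(\<Prod>al\<in>level n. 1183 - 27 * al) \<in> M" unfolding prod_level_crit M_of_int .
  moreover have "1183 - 27 * al \<in> OQ" if "al \<in> level n" for al
    using level_OQ[OF that] by (intro OQ_diff OQ_mult OQ_numeral)
  ultimately obtain be where be: "be \<in> level n" "1183 - 27 * be \<in> M"
    using M_prod[OF finite_level, of n "\<lambda>al. 1183 - 27 * al"] by blast
  have "\<forall>al\<in>level n. \<exists>a b c. {a, b, c} \<subseteq> level (Suc n) \<and>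
      ((a - b) * (b - c) * (c - a)) ^ 2 = (al + 7) * (1183 - 27 * al)"
  proof
    fix al assume al: "al \<in> level n"
    obtain a b c where abc0: "a \<noteq> b" "b \<noteq> c" "a \<noteq> c" and abc: "{x. phi x = al} = {a, b, c}"
      "a + b + c = -7" "a * b + b * c + c * a = 0" "a * b * c = al + 7" using level_fibre[OF al] .
    have "phi a = al" "phi b = al" "phi c = al" using abc(1) by auto
    then have "{a, b, c} \<subseteq> level (Suc n)" using al by (simp add: level_Suc)
    then show "\<exists>a b c. {a, b, c} \<subseteq> level (Suc n) \<and>
      ((a - b) * (b - c) * (c - a)) ^ 2 = (al + 7) * (1183 - 27 * al)"
      using phi_discriminant[OF abc(2-4)] by blast
  qed
  then obtain a b c where abc: "\<And>al. al \<in> level n \<Longrightarrow> {a al, b al, c al} \<subseteq> level (Suc n)"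
    "\<And>al. al \<in> level n \<Longrightarrow> ((a al - b al) * (b al - c al) * (c al - a al)) ^ 2 = (al + 7) * (1183 - 27 * al)"
    by metis
  \<comment> \<open>\<open>D^2 = 7 * crit_num n = p^(2k+1) u\<close>, so that division by
    \<open>p^k\<close> leaves \<open>r^2 = p u\<close>.\<close>
  define D where "D = (\<Prod>al\<in>level n. (a al - b al) * (b al - c al) * (c al - a al))"
  define P :: complex where "P = of_int p ^ k"
  define r where "r = D / P"
  have P0: "P \<noteq> 0" using pku(1) by (auto simp: P_def)
  have "D ^ 2 = (\<Prod>al\<in>level n. (al + 7) * (1183 - 27 * al))"
    unfolding D_def prod_power_distrib by (rule prod.cong[OF refl abc(2)])
  also have "\<dots> = of_int (7 * crit_num n)" by (simp add: prod.distrib prod_level_plus_7 prod_level_crit)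
  also have "\<dots> = P ^ 2 * of_int (p * u)"
    unfolding pku(3) by (simp add: P_def power_mult[symmetric] mult.commute[of k])
  finally have r2: "r ^ 2 = of_int (p * u)" using P0 by (simp add: r_def power_divide)
  have inQ: "a al \<in> Qbar" "b al \<in> Qbar" "c al \<in> Qbar" if "al \<in> level n" for al
    using abc(1)[OF that] level_Qbar by auto
  have DQ: "D \<in> Qbar" unfolding D_def using inQ by (intro Qbar_prod Qbar_mult Qbar_diff)
  have PQ: "P \<in> \<rat>" by (simp add: P_def)
  have rQ: "r \<in> Qbar" unfolding r_def divide_inverse by (rule Qbar_mult[OF DQ Qbar_rat]) (use PQ in simp)
  have "algebraic_int (of_int (p * u) :: complex)" by (simp add: int_imp_algebraic_int del: of_int_mult)
  then have "algebraic_int r"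
    by (rule algebraic_int_root[of _ "monom 1 2"])
       (auto simp: poly_monom r2 degree_monom_eq simp del: of_int_mult)
  then have rO: "r \<in> OQ" by (rule OQ_algebraic_int)
  \<comment> \<open>\<open>D\<close> is a polynomial in vertices of level \<open>n + 1\<close> and
    \<open>P\<close> is rational, so \<open>r\<close> lies in the field of that level.\<close>
  have "s r = t r" if st: "s \<in> abs_galois" "t \<in> abs_galois" "\<forall>y\<in>level (Suc n). s y = t y" for s t
  proof -
    have sD: "q D = (\<Prod>al\<in>level n. (q (a al) - q (b al)) * (q (b al) - q (c al)) * (q (c al) - q (a al)))"
      if q: "q \<in> abs_galois" for q
      unfolding D_def
      by (subst galois_prod[OF q]) (auto simp: galois_mult galois_diff q inQ Qbar_mult Qbar_diff)
    have "s D = t D" unfolding sD[OF st(1)] sD[OF st(2)]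
    proof (rule prod.cong)
      fix al assume "al \<in> level n"
      then have "s (a al) = t (a al)" "s (b al) = t (b al)" "s (c al) = t (c al)" using abc(1) st(3) by blast+
      then show "(s (a al) - s (b al)) * (s (b al) - s (c al)) * (s (c al) - s (a al)) =
        (t (a al) - t (b al)) * (t (b al) - t (c al)) * (t (c al) - t (a al))" by simp
    qed simp
    moreover have "q D = q r * P" if q: "q \<in> abs_galois" for q
    proof -
      have "D = r * P" using P0 by (simp add: r_def)
      then have "q D = q r * q P" using galois_mult[OF q rQ Qbar_rat[OF PQ]] by simp
      then show ?thesis using galois_maps_rat[OF q PQ] by simp
    qed
    ultimately have "s r * P = t r * P" using st(1,2) by metis
    then show ?thesis using P0 by simp
  qed
  then have rF: "r \<in> fixed_ring (level (Suc n))" unfolding fixed_ring_def using rO by blast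
  have "\<exists>s\<in>abs_galois. (\<exists>x\<in>level (Suc n). s x \<noteq> x) \<and> (\<forall>x\<in>fixed_ring (level (Suc n)). s x - x \<in> M)"
  proof (rule ramified_imp_inertia[OF finite_level _ _ rF r2 pku(4)])
    show "level (Suc n) \<subseteq> OQ" using level_OQ by blast
    show "s x \<in> level (Suc n)" if "s \<in> abs_galois" "x \<in> level (Suc n)" for s x
      using galois_level that by blast
  qed
  then obtain s x where s: "s \<in> abs_galois" "x \<in> level (Suc n)" "s x \<noteq> x"
    "\<And>x. x \<in> fixed_ring (level (Suc n)) \<Longrightarrow> s x - x \<in> M" by blast
  have "w \<in> fixed_ring (level (Suc n))" if "w \<in> level (Suc n)" for w
    unfolding fixed_ring_def using that level_OQ by blast
  then have "s w - w \<in> M" if "w \<in> level (Suc n)" for w using s(4) that by blast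
  from inertia_is_transposition[OF pku(2) be s(1) this s(2,3)] s(1) show ?thesis by blast
qed

section \<open>Approximation of tree automorphisms\<close>

lemma galois_left_inverse:
  assumes g: "g \<in> abs_galois"
  shows "\<exists>h\<in>abs_galois. \<forall>w\<in>Qbar. h (g w) = w"
proof -
  have bij: "bij_betw g Qbar Qbar" using g by (simp add: abs_galois_def)
  define h where "h = inv_into Qbar g"
  have bi: "bij_betw h Qbar Qbar" unfolding h_def by (rule bij_betw_inv_into[OF bij])
  have l: "h (g w) = w" if "w \<in> Qbar" for w
    unfolding h_def using bij that by (rule bij_betw_inv_into_left)
  have r: "g (h w) = w" if "w \<in> Qbar" for w
    unfolding h_def using bij that by (rule bij_betw_inv_into_right)
  have c: "h w \<in> Qbar" if "w \<in> Qbar" for w using bi that by (rule bij_betwE[THEN bspec])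
  have "h (u + w) = h u + h w \<and> h (u * w) = h u * h w" if uw: "u \<in> Qbar" "w \<in> Qbar" for u w
  proof -
    have "g (h u + h w) = u + w" "g (h u * h w) = u * w"
      using galois_add[OF g c c] galois_mult[OF g c c] uw r by auto
    then show ?thesis using l[OF Qbar_add[OF c c]] l[OF Qbar_mult[OF c c]] uw by metis
  qed
  moreover have "h 1 = 1" using l[of 1] galois_maps_rat[OF g, of 1] Qbar_rat[of 1] by simp
  ultimately have "h \<in> abs_galois" using bi unfolding abs_galois_def by blast
  then show ?thesis using l by blast
qed

lemma phi_surj_level:
  assumes "z \<in> level n"
  obtains a where "a \<in> level (Suc n)" "phi a = z"
proof -
  obtain a b c where "a \<noteq> b" "b \<noteq> c" "a \<noteq> c" "{x. phi x = z} = {a, b, c}"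
    "a + b + c = -7" "a * b + b * c + c * a = 0" "a * b * c = z + 7" using level_fibre[OF assms] .
  then have "phi a = z" by blast
  then show ?thesis using that assms by (simp add: level_Suc)
qed

text \<open>Conjugate the known transposition so that the third point of its fibre becomes the third point
  of the given fibre.\<close>

lemma galois_fibre_transposition:
  assumes n: "n \<ge> 1" and xy: "x \<in> level (Suc n)" "y \<in> level (Suc n)" "x \<noteq> y" "phi x = phi y"
  shows "\<exists>s\<in>abs_galois. s x = y \<and> s y = x \<and> (\<forall>w\<in>level (Suc n) - {x, y}. s w = w)"
proof -
  obtain a b c t where t: "t \<in> abs_galois" and abc: "{a, b, c} \<subseteq> level (Suc n)" "distinct [a, b, c]"
    "phi b = phi a" "phi c = phi a" "t a = b" "t b = a"
    and tw: "\<And>w. w \<in> level (Suc n) - {a, b} \<Longrightarrow> t w = w"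
    using galois_transposition_ex[OF n] by blast
  have al: "phi x \<in> level n" using xy(1) by (simp add: level_Suc)
  define z where "z = -7 - x - y"
  note v = vieta_of_pair[OF refl xy(4)[symmetric] xy(3) z_def]
  have fib: "phi w = phi x \<longleftrightarrow> w = x \<or> w = y \<or> w = z" for w using phi_factor[OF v, of w] by auto
  have "((x - y) * (y - z) * (z - x)) ^ 2 \<noteq> 0"
    unfolding phi_discriminant[OF v] using level_not_critical[OF al] by simp
  then have zne: "z \<noteq> x" "z \<noteq> y" by auto
  have z: "z \<in> level (Suc n)" using fib[of z] al by (simp add: level_Suc)
  \<comment> \<open>In a fibre of three points a transposition is determined by the point it fixes,
    so transitivity on single vertices is enough to conjugate one transposition into
    another.\<close>
  obtain g where g: "g \<in> abs_galois" "g c = z" using galois_transitive[of c "Suc n" z] abc(1) z by auto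
  have gphi: "phi (g w) = phi x" if "w \<in> level (Suc n)" "phi w = phi c" for w
  proof -
    have "phi (g w) = g (phi w)" using galois_phi[OF g(1) level_Qbar[OF that(1)]] by simp
    also have "\<dots> = phi (g c)" using galois_phi[OF g(1) level_Qbar[of c "Suc n"]] abc(1) that(2) by simp
    finally show ?thesis using fib[of z] g(2) by simp
  qed
  have ginj: "g u = g w \<longleftrightarrow> u = w" if "u \<in> level (Suc n)" "w \<in> level (Suc n)" for u w
    using galois_inj[OF g(1)] level_Qbar that by blast
  have "g a \<noteq> z" "g b \<noteq> z" "g a \<noteq> g b" using ginj abc(1,2) g(2) by auto
  moreover have "phi (g a) = phi x" "phi (g b) = phi x" using gphi abc by auto
  ultimately have gab: "{g a, g b} = {x, y}" using fib by auto
  have gimg: "g ` level (Suc n) = level (Suc n)"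
  proof (rule endo_inj_surj[OF finite_level])
    show "g ` level (Suc n) \<subseteq> level (Suc n)" using galois_level[OF g(1)] by blast
    show "inj_on g (level (Suc n))" using ginj by (intro inj_onI) blast
  qed
  obtain gi where gi: "gi \<in> abs_galois" "\<And>w. w \<in> Qbar \<Longrightarrow> gi (g w) = w"
    using galois_left_inverse[OF g(1)] by blast
  define s where "s = g \<circ> (t \<circ> gi)"
  have s: "s \<in> abs_galois" unfolding s_def using galois_comp g(1) t gi(1) by blast
  have sg: "s (g w) = g (t w)" if "w \<in> level (Suc n)" for w
    using gi(2)[OF level_Qbar[OF that]] by (simp add: s_def)
  have "s (g a) = g b" "s (g b) = g a" using sg[of a] sg[of b] abc by auto
  then have "s x = y \<and> s y = x" using gab by (auto simp: doubleton_eq_iff)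
  moreover have "s w = w" if w: "w \<in> level (Suc n) - {x, y}" for w
  proof -
    have "w \<in> g ` level (Suc n)" using gimg w by blast
    then obtain u where u: "u \<in> level (Suc n)" "w = g u" by blast
    then have "u \<notin> {a, b}" using w gab by auto
    then show ?thesis using sg[OF u(1)] tw[of u] u by simp
  qed
  ultimately show ?thesis using s by blast
qed

text \<open>Automorphisms of the tree, as compatible families of permutations of the levels.\<close>

definition level_maps :: "(nat \<Rightarrow> complex \<Rightarrow> complex) \<Rightarrow> bool" where
  "level_maps t \<longleftrightarrow> (\<forall>n. bij_betw (t n) (level n) (level n)) \<and>
     (\<forall>n. \<forall>x\<in>level (Suc n). phi (t (Suc n) x) = t n (phi x))"

lemma level_maps_closed: "level_maps t \<Longrightarrow> x \<in> level n \<Longrightarrow> t n x \<in> level n"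
  unfolding level_maps_def by (meson bij_betwE)

text \<open>Wrong values are corrected one at a time: \<open>s x\<close> and
  \<open>t (Suc n) x\<close> share a fibre, and composing \<open>s\<close> with their transposition
  makes \<open>x\<close> right, so the number of errors decreases.\<close>

lemma galois_approx_step:
  assumes t: "level_maps t" and n: "n \<ge> 1"
    and s: "s \<in> abs_galois" "\<And>x. x \<in> level n \<Longrightarrow> s x = t n x"
  shows "\<exists>s\<in>abs_galois. \<forall>x\<in>level (Suc n). s x = t (Suc n) x"
  using s
proof (induction "card {x \<in> level (Suc n). s x \<noteq> t (Suc n) x}" arbitrary: s rule: less_induct)
  case less
  define D where "D = {x \<in> level (Suc n). s x \<noteq> t (Suc n) x}"
  show ?case
  proof (cases "D = {}")
    case True
    then show ?thesis using less.prems(1) by (intro bexI[of _ s]) (auto simp: D_def)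
  next
    case False
    then obtain x where x: "x \<in> level (Suc n)" "s x \<noteq> t (Suc n) x" by (auto simp: D_def)
    define u v where "u = s x" and "v = t (Suc n) x"
    have u: "u \<in> level (Suc n)" unfolding u_def using galois_level less.prems(1) x(1) by blast
    have v: "v \<in> level (Suc n)" unfolding v_def by (rule level_maps_closed[OF t x(1)])
    have "phi u = s (phi x)" unfolding u_def using galois_phi[OF less.prems(1) level_Qbar[OF x(1)]] by simp
    also have "\<dots> = t n (phi x)" using less.prems(2) x(1) by (simp add: level_Suc)
    also have "\<dots> = phi v" unfolding v_def using t x(1) by (simp add: level_maps_def)
    finally have uv: "phi u = phi v" .
    obtain r where r: "r \<in> abs_galois" "r u = v" "r v = u" "\<And>w. w \<in> level (Suc n) - {u, v} \<Longrightarrow> r w = w"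
      using galois_fibre_transposition[OF n u v _ uv] x(2) unfolding u_def v_def by blast
    have rs: "r \<circ> s \<in> abs_galois" using galois_comp r(1) less.prems(1) by blast
    have tinj: "inj_on (t (Suc n)) (level (Suc n))" using t by (auto simp: level_maps_def bij_betw_def)
    \<comment> \<open>Vertices that are already right have images other than \<open>u\<close> and
      \<open>v\<close>, by injectivity of \<open>s\<close> and \<open>t (Suc n)\<close>.\<close>
    have agree: "(r \<circ> s) w = t (Suc n) w" if w: "w \<in> level (Suc n)" "s w = t (Suc n) w" for w
    proof -
      have "w \<noteq> x" using w x by auto
      then have "s w \<noteq> u" unfolding u_def
        using galois_inj[OF less.prems(1)] level_Qbar w(1) x(1) by blast
      moreover have "s w \<noteq> v" unfolding v_def w(2) using tinj \<open>w \<noteq> x\<close> w(1) x(1) by (auto dest: inj_onD)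
      moreover have "s w \<in> level (Suc n)" using galois_level less.prems(1) w(1) by blast
      ultimately show ?thesis using r(4)[of "s w"] w(2) by simp
    qed
    have "(r \<circ> s) x = t (Suc n) x" using r(2) by (simp add: u_def v_def)
    then have "{w \<in> level (Suc n). (r \<circ> s) w \<noteq> t (Suc n) w} \<subset> D"
      using agree x unfolding D_def by blast
    moreover have "finite D" unfolding D_def using finite_level by simp
    ultimately have "card {w \<in> level (Suc n). (r \<circ> s) w \<noteq> t (Suc n) w} < card D" by (rule psubset_card_mono[rotated])
    moreover have "(r \<circ> s) w = t n w" if w: "w \<in> level n" for w
    proof -
      \<comment> \<open>\<open>r\<close> moves points of level \<open>n + 1\<close> only within a
        fibre, so it fixes their images under \<open>phi\<close>, which make up level
        \<open>n\<close>.\<close>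
      have "r z = z" if z: "z \<in> level n" for z
      proof -
        obtain a where aL: "a \<in> level (Suc n)" and a: "phi a = z" using phi_surj_level[OF z] .
        have "phi (r a) = z"
        proof (cases "a \<in> {u, v}")
          case True
          then show ?thesis using r(2,3) uv a by auto
        next
          case False
          then show ?thesis using r(4) aL a by simp
        qed
        then show ?thesis using galois_phi[OF r(1) level_Qbar[OF aL]] a by simp
      qed
      moreover have "s w \<in> level n" using galois_level less.prems(1) w by blast
      ultimately show ?thesis using less.prems(2) w by simp
    qed
    ultimately show ?thesis using less.hyps[OF _ rs] unfolding D_def by blast
  qed
qed

lemma agree_on_lower_level:
  assumes "s \<in> abs_galois" "t \<in> abs_galois" "\<forall>x\<in>level (Suc n). s x = t x" "z \<in> level n"
  shows "s z = t z"
proof -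
  obtain a where aL: "a \<in> level (Suc n)" and a: "phi a = z" using phi_surj_level[OF assms(4)] .
  then show ?thesis using galois_phi[OF assms(1) level_Qbar[OF aL]] galois_phi[OF assms(2) level_Qbar[OF aL]]
      assms(3) a by simp
qed

lemma agree_on_lower_levels:
  assumes "s \<in> abs_galois" "t \<in> abs_galois" "m \<le> n" "\<forall>x\<in>level n. s x = t x"
  shows "\<forall>x\<in>level m. s x = t x"
  using assms(3,4)
proof (induction n rule: dec_induct)
  case (step n)
  then show ?case using agree_on_lower_level[OF assms(1,2)] by blast
qed

text \<open>The approximations \<open>\<sigma> n\<close> are compatible only on the fields of the
  levels. On the union of these fields they define one homomorphism, which extends to
  \<open>Qbar\<close>.\<close>

lemma galois_image_closed:
  assumes t: "level_maps t" and approx: "\<And>n. \<exists>s\<in>abs_galois. \<forall>x\<in>level n. s x = t n x"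
  shows "\<exists>s\<in>abs_galois. \<forall>n. \<forall>x\<in>level n. s x = t n x"
proof -
  obtain \<sigma> where \<sigma>: "\<And>n. \<sigma> n \<in> abs_galois" and \<sigma>t: "\<And>n x. x \<in> level n \<Longrightarrow> \<sigma> n x = t n x"
    using approx by metis
  \<comment> \<open>\<open>K n\<close> is the field generated by level \<open>n\<close>, described
    through Galois so that automorphisms agreeing on the level agree on it by definition.\<close>
  define K where "K = (\<lambda>n. {x \<in> Qbar. \<forall>r\<in>abs_galois. \<forall>s\<in>abs_galois. (\<forall>y\<in>level n. r y = s y) \<longrightarrow> r x = s x})"
  have KQ: "x \<in> Qbar" if "x \<in> K n" for x n using that by (simp add: K_def)
  have KD: "r x = s x" if "x \<in> K n" "r \<in> abs_galois" "s \<in> abs_galois" "\<forall>y\<in>level n. r y = s y" for r s x n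
    using that unfolding K_def by blast
  have KI: "x \<in> K n" if "x \<in> Qbar"
    "\<And>r s. r \<in> abs_galois \<Longrightarrow> s \<in> abs_galois \<Longrightarrow> \<forall>y\<in>level n. r y = s y \<Longrightarrow> r x = s x" for x n
    using that unfolding K_def by blast
  have mono: "K m \<subseteq> K n" if "m \<le> n" for m n
  proof
    fix x assume x: "x \<in> K m"
    show "x \<in> K n"
      by (rule KI[OF KQ[OF x]]) (use KD[OF x] agree_on_lower_levels[OF _ _ that] in blast)
  qed
  have KL: "x \<in> K n" if "x \<in> level n" for x n
    by (rule KI[OF level_Qbar[OF that]]) (use that in blast)
  have Krat: "q \<in> K n" if "q \<in> \<rat>" for q n
    by (rule KI[OF Qbar_rat[OF that]]) (simp add: galois_maps_rat that)
  have Kadd: "x + y \<in> K n" if xy: "x \<in> K n" "y \<in> K n" for x y n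
  proof (rule KI[OF Qbar_add[OF KQ[OF xy(1)] KQ[OF xy(2)]]])
    fix r s assume rs: "r \<in> abs_galois" "s \<in> abs_galois" "\<forall>y\<in>level n. r y = s y"
    then show "r (x + y) = s (x + y)"
      using KD[OF xy(1) rs] KD[OF xy(2) rs] KQ[OF xy(1)] KQ[OF xy(2)] by (simp add: galois_add)
  qed
  have Kmult: "x * y \<in> K n" if xy: "x \<in> K n" "y \<in> K n" for x y n
  proof (rule KI[OF Qbar_mult[OF KQ[OF xy(1)] KQ[OF xy(2)]]])
    fix r s assume rs: "r \<in> abs_galois" "s \<in> abs_galois" "\<forall>y\<in>level n. r y = s y"
    then show "r (x * y) = s (x * y)"
      using KD[OF xy(1) rs] KD[OF xy(2) rs] KQ[OF xy(1)] KQ[OF xy(2)] by (simp add: galois_mult)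
  qed
  define F where "F = {(x, \<sigma> n x) | n x. x \<in> K n}"
  have FI: "(x, \<sigma> n x) \<in> F" if "x \<in> K n" for x n using that unfolding F_def by blast
  have low: "\<forall>y\<in>level m. \<sigma> n y = t m y" if "m \<le> n" for m n
    using that
  proof (induction m rule: inc_induct)
    case base
    then show ?case using \<sigma>t by blast
  next
    case (step m)
    show ?case
    proof
      fix y assume "y \<in> level m"
      then obtain a where a: "a \<in> level (Suc m)" "phi a = y" by (rule phi_surj_level)
      then have "\<sigma> n y = phi (\<sigma> n a)" using galois_phi[OF \<sigma> level_Qbar[OF a(1)]] by simp
      also have "\<dots> = phi (t (Suc m) a)" using step.IH a(1) by simp
      also have "\<dots> = t m y" using t a unfolding level_maps_def by blast
      finally show "\<sigma> n y = t m y" .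
    qed
  qed
  have coh: "\<sigma> m x = \<sigma> n x" if "m \<le> n" "x \<in> K m" for m n x
    by (rule KD[OF that(2) \<sigma> \<sigma>]) (use low[OF that(1)] \<sigma>t in simp)
  have "hom_graph F"
    unfolding hom_graph_def
  proof (intro conjI ballI allI impI)
    fix q :: complex assume q: "q \<in> \<rat>"
    then show "(q, q) \<in> F" using FI[OF Krat[OF q], of 0] galois_maps_rat[OF \<sigma> q, of 0] by simp
  next
    fix x x' y y' assume "(x, x') \<in> F" "(y, y') \<in> F"
    then obtain m n where mn: "x \<in> K m" "x' = \<sigma> m x" "y \<in> K n" "y' = \<sigma> n y" by (auto simp: F_def)
    define l where "l = max m n"
    have x: "x \<in> K l" "x' = \<sigma> l x" and y: "y \<in> K l" "y' = \<sigma> l y"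
      using mn mono[of m l] mono[of n l] coh[of m l x] coh[of n l y] by (auto simp: l_def)
    show "(x + y, x' + y') \<in> F"
      using FI[OF Kadd[OF x(1) y(1)]] galois_add[OF \<sigma> KQ[OF x(1)] KQ[OF y(1)], of l] x(2) y(2) by simp
    show "(x * y, x' * y') \<in> F"
      using FI[OF Kmult[OF x(1) y(1)]] galois_mult[OF \<sigma> KQ[OF x(1)] KQ[OF y(1)], of l] x(2) y(2) by simp
  next
    fix y assume "(0, y) \<in> F"
    then obtain n where "y = \<sigma> n 0" by (auto simp: F_def)
    then show "y = 0" using galois_maps_rat[OF \<sigma>, of 0 n] by simp
  next
    fix x y assume "(x, y) \<in> F"
    then show "algebraic x" using KQ by (auto simp: F_def Qbar_def)
  qed
  then obtain s where s: "s \<in> abs_galois" "\<And>x y. (x, y) \<in> F \<Longrightarrow> s x = y"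
    using hom_graph_extends by blast
  have "s x = t n x" if "x \<in> level n" for n x using s(2)[OF FI[OF KL[OF that]]] \<sigma>t[OF that] by simp
  then show ?thesis using s(1) by blast
qed

section \<open>The automorphism group of the tree\<close>

lemma tree_verts_level: "(n, z) \<in> tree_verts \<longleftrightarrow> z \<in> level n"
  by (simp add: tree_verts_def level_def)

lemma tree_adj_up: "z \<in> level (Suc n) \<Longrightarrow> tree_adj (Suc n, z) (n, phi z)"
  by (auto simp: tree_adj_def tree_verts_level level_Suc)

lemma card_fibre:
  assumes "al \<in> level n"
  shows "finite {x. phi x = al}" "card {x. phi x = al} = 3"
proof -
  obtain a b c where "a \<noteq> b" "b \<noteq> c" "a \<noteq> c" "{x. phi x = al} = {a, b, c}"
    "a + b + c = -7" "a * b + b * c + c * a = 0" "a * b * c = al + 7" using level_fibre[OF assms] .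
  then show "finite {x. phi x = al}" "card {x. phi x = al} = 3" by auto
qed

lemma neighbours_root: "{v. tree_adj (0, 0) v} = Pair 1 ` {x. phi x = 0}"
  by (auto simp: tree_adj_def tree_verts_level level_0 level_Suc)

lemma neighbours_Suc:
  assumes "z \<in> level (Suc n)"
  shows "{v. tree_adj (Suc n, z) v} = insert (n, phi z) (Pair (Suc (Suc n)) ` {x. phi x = z})"
  using assms by (auto simp: tree_adj_def tree_verts_level level_Suc)

lemma card_neighbours_root: "card {v. tree_adj (0, 0) v} = 3"
  unfolding neighbours_root using card_fibre[of 0 0] by (subst card_image) (auto simp: level_0 inj_on_def)

lemma card_neighbours_Suc:
  assumes "z \<in> level (Suc n)"
  shows "card {v. tree_adj (Suc n, z) v} = 4"
proof -
  have "card (Pair (Suc (Suc n)) ` {x. phi x = z}) = 3"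
    using card_fibre[OF assms] by (subst card_image) (auto simp: inj_on_def)
  then show ?thesis unfolding neighbours_Suc[OF assms]
    using card_fibre[OF assms] by (subst card_insert_disjoint) auto
qed

lemma tree_aut_bij: "f \<in> tree_aut \<Longrightarrow> bij_betw f tree_verts tree_verts"
  by (simp add: tree_aut_def Bij_def)

lemma tree_aut_adj: "f \<in> tree_aut \<Longrightarrow> u \<in> tree_verts \<Longrightarrow> v \<in> tree_verts \<Longrightarrow> tree_adj (f u) (f v) = tree_adj u v"
  by (simp add: tree_aut_def)

lemma tree_aut_card_neighbours:
  assumes f: "f \<in> tree_aut" and u: "u \<in> tree_verts"
  shows "card {v. tree_adj (f u) v} = card {v. tree_adj u v}"
proof -
  have verts: "v \<in> tree_verts" if "tree_adj w v" for v w using that by (simp add: tree_adj_def)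
  have "f ` {v. tree_adj u v} = {v. tree_adj (f u) v}"
  proof (intro equalityI subsetI)
    fix w assume "w \<in> f ` {v. tree_adj u v}"
    then obtain v where "tree_adj u v" "w = f v" by blast
    then show "w \<in> {v. tree_adj (f u) v}" using tree_aut_adj[OF f u verts] by blast
  next
    fix w assume w: "w \<in> {v. tree_adj (f u) v}"
    then have "w \<in> f ` tree_verts" using verts tree_aut_bij[OF f] by (auto simp: bij_betw_def)
    then obtain v where "v \<in> tree_verts" "w = f v" by blast
    then show "w \<in> f ` {v. tree_adj u v}" using w tree_aut_adj[OF f u] by blast
  qed
  moreover have "inj_on f {v. tree_adj u v}"
    by (rule inj_on_subset[OF bij_betw_imp_inj_on[OF tree_aut_bij[OF f]]]) (use verts in blast)
  ultimately show ?thesis using card_image by metis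
qed

text \<open>The root is the only vertex with three rather than four neighbours.\<close>

lemma tree_aut_root:
  assumes f: "f \<in> tree_aut"
  shows "f (0, 0) = (0, 0)"
proof -
  have r: "(0, 0) \<in> tree_verts" by (simp add: tree_verts_level level_0)
  obtain n z where nz: "f (0, 0) = (n, z)" by force
  have z: "z \<in> level n" using tree_aut_bij[OF f] r nz by (metis bij_betwE tree_verts_level)
  have "card {v. tree_adj (n, z) v} = 3"
    using tree_aut_card_neighbours[OF f r] card_neighbours_root nz by simp
  then have "n = 0" using card_neighbours_Suc z by (cases n) auto
  then show ?thesis using z nz by (simp add: level_0)
qed

text \<open>Adjacency leaves the alternative that a vertex is mapped to the parent of the image of
  its parent. By induction that place is taken by the image of its grandparent, contrary to
  injectivity.\<close>

lemma tree_aut_parent: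
  assumes f: "f \<in> tree_aut"
  shows "z \<in> level n \<Longrightarrow> fst (f (n, z)) = n \<and> (n > 0 \<longrightarrow> phi (snd (f (n, z))) = snd (f (n - 1, phi z)))"
proof (induction n arbitrary: z rule: less_induct)
  case (less n)
  show ?case
  proof (cases n)
    case 0
    then show ?thesis using less.prems tree_aut_root[OF f] by (simp add: level_0)
  next
    case (Suc m)
    have zL: "z \<in> level (Suc m)" using less.prems Suc by simp
    then have pL: "phi z \<in> level m" by (simp add: level_Suc)
    have V: "(Suc m, z) \<in> tree_verts" "(m, phi z) \<in> tree_verts" using zL pL by (simp_all add: tree_verts_level)
    define u where "u = snd (f (m, phi z))"
    have fp: "f (m, phi z) = (m, u)" using less.IH[of m "phi z"] Suc pL by (simp add: u_def prod_eq_iff)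
    obtain k y where ky: "f (Suc m, z) = (k, y)" by force
    have "tree_adj (k, y) (m, u)" using tree_aut_adj[OF f V] tree_adj_up[OF zL] fp ky by simp
    then have "(k = Suc m \<and> phi y = u) \<or> (m = Suc k \<and> phi u = y)" by (simp add: tree_adj_def)
    moreover have False if bad: "m = Suc k" "phi u = y"
    proof -
      have pL': "phi (phi z) \<in> level k" using pL bad by (simp add: level_Suc)
      have "fst (f (k, phi (phi z))) = k" using less.IH[of k] Suc bad pL' by simp
      moreover have "phi u = snd (f (k, phi (phi z)))" using less.IH[of m "phi z"] Suc bad pL by (simp add: u_def)
      ultimately have "f (k, phi (phi z)) = f (Suc m, z)" using ky bad by (simp add: prod_eq_iff)
      moreover have "(k, phi (phi z)) \<in> tree_verts" using pL' by (simp add: tree_verts_level)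
      ultimately have "(k, phi (phi z)) = (Suc m, z)"
        using tree_aut_bij[OF f] V(1) by (meson bij_betw_def inj_onD)
      then show False using bad by simp
    qed
    ultimately have "k = Suc m" "phi y = u" by blast+
    then show ?thesis using Suc ky by (simp add: u_def)
  qed
qed

definition level_part :: "(nat \<times> complex \<Rightarrow> nat \<times> complex) \<Rightarrow> nat \<Rightarrow> complex \<Rightarrow> complex" where
  "level_part f n z = snd (f (n, z))"

lemma tree_aut_apply: "f \<in> tree_aut \<Longrightarrow> z \<in> level n \<Longrightarrow> f (n, z) = (n, level_part f n z)"
  using tree_aut_parent[of f z n] by (simp add: level_part_def prod_eq_iff)

lemma bij_betw_level:
  "(\<And>x. x \<in> level n \<Longrightarrow> g x \<in> level n) \<Longrightarrow> inj_on g (level n) \<Longrightarrow> bij_betw g (level n) (level n)"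
  unfolding bij_betw_def using endo_inj_surj[OF finite_level, of g n] by blast

lemma level_maps_level_part:
  assumes f: "f \<in> tree_aut"
  shows "level_maps (level_part f)"
  unfolding level_maps_def
proof (intro conjI allI ballI)
  fix n
  show "bij_betw (level_part f n) (level n) (level n)"
  proof (rule bij_betw_level)
    fix x assume x: "x \<in> level n"
    then have "f (n, x) \<in> tree_verts" using tree_aut_bij[OF f] by (meson bij_betwE tree_verts_level)
    then show "level_part f n x \<in> level n" using tree_aut_apply[OF f x] by (simp add: tree_verts_level)
  next
    show "inj_on (level_part f n) (level n)"
    proof (rule inj_onI)
      fix x y assume xy: "x \<in> level n" "y \<in> level n" "level_part f n x = level_part f n y"
      then have "f (n, x) = f (n, y)" using tree_aut_apply[OF f] by simp
      then have "(n, x) = (n, y)"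
        using tree_aut_bij[OF f] xy(1,2) by (meson bij_betw_def inj_onD tree_verts_level)
      then show "x = y" by simp
    qed
  qed
next
  fix n x assume "x \<in> level (Suc n)"
  then show "phi (level_part f (Suc n) x) = level_part f n (phi x)"
    using tree_aut_parent[OF f, of x "Suc n"] by (simp add: level_part_def)
qed

definition tree_map :: "(nat \<Rightarrow> complex \<Rightarrow> complex) \<Rightarrow> nat \<times> complex \<Rightarrow> nat \<times> complex" where
  "tree_map t = (\<lambda>v\<in>tree_verts. (fst v, t (fst v) (snd v)))"

lemma tree_map_apply: "z \<in> level n \<Longrightarrow> tree_map t (n, z) = (n, t n z)"
  by (simp add: tree_map_def tree_verts_level)

lemma tree_map_in_tree_aut:
  assumes t: "level_maps t"
  shows "tree_map t \<in> tree_aut"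
proof -
  have inj: "t n x = t n y \<longleftrightarrow> x = y" if "x \<in> level n" "y \<in> level n" for n x y
    using t that unfolding level_maps_def by (meson bij_betw_def inj_on_eq_iff)
  have L: "t n x \<in> level n" if "x \<in> level n" for n x by (rule level_maps_closed[OF t that])
  have "bij_betw (tree_map t) tree_verts tree_verts"
    unfolding bij_betw_def
  proof (intro conjI inj_onI equalityI subsetI)
    fix u v assume "u \<in> tree_verts" "v \<in> tree_verts" "tree_map t u = tree_map t v"
    then show "u = v"
      by (cases u; cases v) (auto simp: tree_verts_level tree_map_apply inj)
  next
    fix u assume "u \<in> tree_map t ` tree_verts"
    then show "u \<in> tree_verts" by (auto simp: tree_verts_level tree_map_apply L)
  next
    fix u assume u: "u \<in> tree_verts"
    obtain n z where nz: "u = (n, z)" by force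
    then have "z \<in> t n ` level n" using t u by (auto simp: level_maps_def bij_betw_def tree_verts_level)
    then obtain y where y: "y \<in> level n" "z = t n y" by blast
    then have "u = tree_map t (n, y)" by (simp add: nz tree_map_apply)
    then show "u \<in> tree_map t ` tree_verts" using y(1) tree_verts_level by blast
  qed
  moreover have "tree_adj (tree_map t u) (tree_map t v) \<longleftrightarrow> tree_adj u v"
    if uv: "u \<in> tree_verts" "v \<in> tree_verts" for u v
  proof -
    obtain m x n y where mx: "u = (m, x)" and ny: "v = (n, y)" by (metis surj_pair)
    have x: "x \<in> level m" and y: "y \<in> level n" using uv by (simp_all add: mx ny tree_verts_level)
    have key: "phi (t (Suc k) a) = t k b \<longleftrightarrow> phi a = b" if ab: "a \<in> level (Suc k)" "b \<in> level k" for k a b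
    proof -
      have "phi (t (Suc k) a) = t k (phi a)" using t ab(1) by (simp add: level_maps_def)
      then show ?thesis using inj[of "phi a" k b] ab by (simp add: level_Suc)
    qed
    show ?thesis unfolding mx ny tree_map_apply[OF x] tree_map_apply[OF y]
      using x y L[OF x] L[OF y] key[of x n y] key[of y m x]
      by (auto simp: tree_adj_def tree_verts_level)
  qed
  moreover have "tree_map t \<in> extensional tree_verts" by (simp add: tree_map_def)
  ultimately show ?thesis unfolding tree_aut_def Bij_def by blast
qed

lemma tree_aut_eq_tree_map:
  assumes f: "f \<in> tree_aut"
  shows "f = tree_map (level_part f)"
proof
  fix v :: "nat \<times> complex"
  obtain n z where v: "v = (n, z)" by force
  show "f v = tree_map (level_part f) v"
  proof (cases "z \<in> level n")
    case True
    then show ?thesis using tree_aut_apply[OF f True] by (simp add: v tree_map_apply)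
  next
    case False
    then have nv: "v \<notin> tree_verts" by (simp add: v tree_verts_level)
    have "f \<in> extensional tree_verts" using f by (simp add: tree_aut_def Bij_def)
    from extensional_arb[OF this nv] show ?thesis using nv by (simp add: tree_map_def)
  qed
qed

lemma tree_map_cong: "(\<And>n x. x \<in> level n \<Longrightarrow> t n x = t' n x) \<Longrightarrow> tree_map t = tree_map t'"
  unfolding tree_map_def by (intro restrict_ext) (auto simp: tree_verts_level)

lemma galois_action_eq: "galois_action s = tree_map (\<lambda>_. s)"
  by (simp add: galois_action_def tree_map_def)

lemma galois_level_maps:
  assumes s: "s \<in> abs_galois"
  shows "level_maps (\<lambda>_. s)"
  unfolding level_maps_def
proof (intro conjI allI ballI bij_betw_level)
  show "s x \<in> level n" if "x \<in> level n" for n x using galois_level[OF s that] .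
  show "inj_on s (level n)" for n using galois_inj[OF s] level_Qbar by (intro inj_onI) blast
  show "phi (s x) = s (phi x)" if "x \<in> level (Suc n)" for n x using galois_phi[OF s level_Qbar[OF that]] by simp
qed

lemma subgroup_tree_aut: "subgroup tree_aut (BijGroup tree_verts)"
proof -
  interpret B: group "BijGroup tree_verts" by (rule group_BijGroup)
  have carr: "tree_aut \<subseteq> Bij tree_verts" by (auto simp: tree_aut_def)
  have maps: "f u \<in> tree_verts" if "f \<in> Bij tree_verts" "u \<in> tree_verts" for f u
    using that by (auto simp: Bij_def bij_betw_def)
  show ?thesis
  proof (rule B.subgroupI)
    show "tree_aut \<subseteq> carrier (BijGroup tree_verts)" using carr by (simp add: BijGroup_def)
    show "tree_aut \<noteq> {}" using tree_map_in_tree_aut[OF galois_level_maps[OF galois_id]] by blast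
  next
    fix f assume f: "f \<in> tree_aut"
    then have fB: "f \<in> Bij tree_verts" using carr by blast
    define g where "g = (\<lambda>x\<in>tree_verts. inv_into tree_verts f x)"
    have gB: "g \<in> Bij tree_verts" unfolding g_def by (rule restrict_inv_into_Bij[OF fB])
    have fg: "f (g u) = u" if "u \<in> tree_verts" for u
      using tree_aut_bij[OF f] that by (simp add: g_def bij_betw_inv_into_right)
    have "tree_adj (g u) (g v) = tree_adj u v" if "u \<in> tree_verts" "v \<in> tree_verts" for u v
      using tree_aut_adj[OF f maps[OF gB that(1)] maps[OF gB that(2)]] fg that by simp
    then have "g \<in> tree_aut" using gB by (simp add: tree_aut_def)
    then show "inv\<^bsub>BijGroup tree_verts\<^esub> f \<in> tree_aut" by (simp add: inv_BijGroup[OF fB] g_def)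
  next
    fix f g assume fg: "f \<in> tree_aut" "g \<in> tree_aut"
    then have B: "f \<in> Bij tree_verts" "g \<in> Bij tree_verts" using carr by blast+
    have "tree_adj (f (g u)) (f (g v)) = tree_adj u v" if "u \<in> tree_verts" "v \<in> tree_verts" for u v
      using tree_aut_adj[OF fg(1) maps[OF B(2) that(1)] maps[OF B(2) that(2)]] tree_aut_adj[OF fg(2) that] by simp
    then show "f \<otimes>\<^bsub>BijGroup tree_verts\<^esub> g \<in> tree_aut"
      using compose_Bij[OF B] B by (simp add: BijGroup_def tree_aut_def compose_def)
  qed
qed

lemma group_AutT: "group AutT"
  unfolding AutT_def using subgroup.subgroup_is_group[OF subgroup_tree_aut group_BijGroup] .

lemma carrier_AutT: "carrier AutT = tree_aut"
  by (simp add: AutT_def)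

lemma mult_AutT: "f \<in> tree_aut \<Longrightarrow> g \<in> tree_aut \<Longrightarrow> f \<otimes>\<^bsub>AutT\<^esub> g = compose tree_verts f g"
  by (auto simp: AutT_def BijGroup_def tree_aut_def)

text \<open>The cosets of the kernel are the two fibres of \<open>sg\<close>. Values are complex
  because \<open>sg\<close> will be a quotient of difference products.\<close>

lemma (in group) index_2_kernel:
  fixes sg :: "'a \<Rightarrow> complex"
  assumes hom: "\<And>x y. x \<in> carrier G \<Longrightarrow> y \<in> carrier G \<Longrightarrow> sg (x \<otimes> y) = sg x * sg y"
    and val: "\<And>x. x \<in> carrier G \<Longrightarrow> sg x = 1 \<or> sg x = -1"
    and t: "t \<in> carrier G" "sg t = -1"
  shows "subgroup {x \<in> carrier G. sg x = 1} G \<and> card (rcosets {x \<in> carrier G. sg x = 1}) = 2"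
proof -
  define H where "H = {x \<in> carrier G. sg x = 1}"
  have one: "sg \<one> = 1" using hom[of \<one> t] t by simp
  have inv: "sg (inv x) = sg x" if "x \<in> carrier G" for x
    using hom[of "inv x" x] val[of x] val[of "inv x"] that one by auto
  have sub: "subgroup H G"
    by (rule subgroupI) (use one inv hom in \<open>auto simp: H_def intro: one_closed\<close>)
  have coset: "H #> x = {y \<in> carrier G. sg y = sg x}" if x: "x \<in> carrier G" for x
  proof (intro equalityI subsetI)
    fix y assume "y \<in> H #> x"
    then show "y \<in> {y \<in> carrier G. sg y = sg x}" using x hom by (auto simp: r_coset_def H_def)
  next
    fix y assume y: "y \<in> {y \<in> carrier G. sg y = sg x}"
    then have "y \<otimes> inv x \<in> H" using x hom inv val[of x] by (auto simp: H_def)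
    moreover have "y = y \<otimes> inv x \<otimes> x" using x y by (simp add: m_assoc)
    ultimately show "y \<in> H #> x" unfolding r_coset_def by blast
  qed
  have "rcosets H = {H #> \<one>, H #> t}"
  proof (intro equalityI subsetI)
    fix C assume "C \<in> rcosets H"
    then obtain x where "x \<in> carrier G" "C = H #> x" by (auto simp: RCOSETS_def)
    then show "C \<in> {H #> \<one>, H #> t}" using val[of x] t one coset by auto
  qed (use t in \<open>auto simp: RCOSETS_def\<close>)
  moreover have "H #> \<one> \<noteq> H #> t"
  proof
    assume eq: "H #> \<one> = H #> t"
    have "\<one> \<in> H #> \<one>" unfolding coset[OF one_closed] by simp
    then show False unfolding eq coset[OF t(1)] using one t(2) by simp
  qed
  ultimately show ?thesis using sub by (simp add: H_def)
qed

section \<open>An odd automorphism and the sign on the first level\<close>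

definition fibre_bij :: "complex \<Rightarrow> complex \<Rightarrow> complex \<Rightarrow> complex" where
  "fibre_bij al be = (SOME g. bij_betw g {x. phi x = al} {x. phi x = be})"

lemma fibre_bij:
  assumes "al \<in> level n" "be \<in> level n"
  shows "bij_betw (fibre_bij al be) {x. phi x = al} {x. phi x = be}"
proof -
  have "\<exists>g. bij_betw g {x. phi x = al} {x. phi x = be}"
    by (rule finite_same_card_bij) (use card_fibre[OF assms(1)] card_fibre[OF assms(2)] in auto)
  then show ?thesis unfolding fibre_bij_def by (rule someI_ex)
qed

text \<open>An odd tree automorphism, which shows that the index is not 1. On deeper levels each
  fibre is carried along by a chosen bijection.\<close>

fun branch_swap :: "complex \<Rightarrow> complex \<Rightarrow> nat \<Rightarrow> complex \<Rightarrow> complex" where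
  "branch_swap a b 0 x = x"
| "branch_swap a b (Suc 0) x = (if x = a then b else if x = b then a else x)"
| "branch_swap a b (Suc (Suc n)) x = fibre_bij (phi x) (branch_swap a b (Suc n) (phi x)) x"

lemma level_maps_branch_swap:
  assumes a: "a \<in> level 1" and b: "b \<in> level 1"
  shows "level_maps (branch_swap a b)"
proof -
  have ind: "(\<forall>x\<in>level n. branch_swap a b n x \<in> level n \<and>
      (n > 0 \<longrightarrow> phi (branch_swap a b n x) = branch_swap a b (n - 1) (phi x))) \<and>
    inj_on (branch_swap a b n) (level n)" for n
  proof (induction n)
    case 0
    then show ?case by (simp add: level_0)
  next
    case (Suc m)
    show ?case
    proof (cases m)
      case 0
      have root: "phi x = 0" if "x \<in> level (Suc 0)" for x using that by (simp add: level_Suc level_0)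
      have "phi a = 0" "phi b = 0" using a b root by simp_all
      then show ?thesis using a b root unfolding 0 by (auto simp: inj_on_def)
    next
      case (Suc k)
      define t where "t = branch_swap a b"
      have IH: "t m y \<in> level m" if "y \<in> level m" for y using Suc.IH that by (simp add: t_def)
      have IHinj: "inj_on (t m) (level m)" using Suc.IH by (simp add: t_def)
      have eq: "t (Suc m) x = fibre_bij (phi x) (t m (phi x)) x" for x by (simp add: t_def Suc)
      have bij: "bij_betw (fibre_bij (phi x) (t m (phi x))) {y. phi y = phi x} {y. phi y = t m (phi x)}"
        if "x \<in> level (Suc m)" for x
        using that IH by (intro fibre_bij[of _ m]) (simp_all add: level_Suc)
      have par: "phi (t (Suc m) x) = t m (phi x)" if "x \<in> level (Suc m)" for x
        using bij_betwE[OF bij[OF that]] unfolding eq by blast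
      have "inj_on (t (Suc m)) (level (Suc m))"
      proof (rule inj_onI)
        fix x y assume xy: "x \<in> level (Suc m)" "y \<in> level (Suc m)" "t (Suc m) x = t (Suc m) y"
        have "t m (phi x) = t m (phi y)" using par xy by metis
        then have p: "phi x = phi y" using IHinj xy(1,2) by (meson inj_onD level_Suc)
        show "x = y"
          using bij[OF xy(1)] xy(3) p unfolding eq bij_betw_def by (auto dest: inj_onD)
      qed
      moreover have "t (Suc m) x \<in> level (Suc m)" if "x \<in> level (Suc m)" for x
        using par[OF that] IH that by (simp add: level_Suc)
      ultimately show ?thesis using par by (simp add: t_def)
    qed
  qed
  show ?thesis
    unfolding level_maps_def
  proof (intro conjI allI ballI bij_betw_level)
    show "branch_swap a b n x \<in> level n" if "x \<in> level n" for n x using ind that by blast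
    show "inj_on (branch_swap a b n) (level n)" for n using ind by blast
    show "phi (branch_swap a b (Suc n) x) = branch_swap a b n (phi x)" if "x \<in> level (Suc n)" for n x
      using ind[of "Suc n"] that by simp
  qed
qed

text \<open>A square root of the discriminant; permuting the arguments multiplies it by the sign,
  which is how signs are read off.\<close>

definition vandermonde3 :: "complex \<Rightarrow> complex \<Rightarrow> complex \<Rightarrow> complex" where
  "vandermonde3 a b c = (a - b) * (b - c) * (c - a)"

lemma vandermonde3_perms:
  fixes a b c :: complex
  shows "vandermonde3 a c b = - vandermonde3 a b c" "vandermonde3 b a c = - vandermonde3 a b c"
  "vandermonde3 c b a = - vandermonde3 a b c" "vandermonde3 b c a = vandermonde3 a b c"
  "vandermonde3 c a b = vandermonde3 a b c"
  by (simp_all add: vandermonde3_def algebra_simps)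

lemma bij_betw_three_cases:
  assumes "distinct [a, b, c]" "bij_betw g {a, b, c} {a, b, c}"
  shows "(g a = a \<and> g b = b \<and> g c = c) \<or> (g a = a \<and> g b = c \<and> g c = b) \<or>
    (g a = b \<and> g b = a \<and> g c = c) \<or> (g a = b \<and> g b = c \<and> g c = a) \<or>
    (g a = c \<and> g b = a \<and> g c = b) \<or> (g a = c \<and> g b = b \<and> g c = a)"
proof -
  have "g a \<in> {a, b, c}" "g b \<in> {a, b, c}" "g c \<in> {a, b, c}"
    using bij_betwE[OF assms(2)] by simp_all
  moreover have "g a \<noteq> g b" "g b \<noteq> g c" "g a \<noteq> g c"
    using assms by (auto simp: bij_betw_def inj_on_eq_iff)
  ultimately show ?thesis by auto
qed

lemma vandermonde3_perm:
  assumes "distinct [a, b, c]" "bij_betw g {a, b, c} {a, b, c}"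
  shows "vandermonde3 (g a) (g b) (g c) = vandermonde3 a b c \<or>
    vandermonde3 (g a) (g b) (g c) = - vandermonde3 a b c"
  using bij_betw_three_cases[OF assms] by (elim disjE conjE) (simp_all add: vandermonde3_perms[where a = a and b = b and c = c])

text \<open>Multiplicativity of the sign, with denominators cleared; \<open>h\<close> is arbitrary,
  as the identity concerns only the rearrangement of its values by \<open>g\<close>.\<close>

lemma vandermonde3_comp:
  assumes "distinct [a, b, c]" "bij_betw g {a, b, c} {a, b, c}"
  shows "vandermonde3 (h (g a)) (h (g b)) (h (g c)) * vandermonde3 a b c =
    vandermonde3 (h a) (h b) (h c) * vandermonde3 (g a) (g b) (g c)"
  using bij_betw_three_cases[OF assms]
  by (elim disjE conjE) (simp_all add: vandermonde3_perms[where a = a and b = b and c = c] vandermonde3_perms[where a = "h a" and b = "h b" and c = "h c"])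

lemma level_1_fibre: "level 1 = {x. phi x = 0}"
  using level_Suc[of _ 0] by (auto simp: level_0)

text \<open>The discriminant \<open>7 * 1183 = 91\<^sup>2\<close> of \<open>phi\<close> is a square, which forces Galois to act by even permutations.\<close>

lemma level_1:
  obtains a b c where "level 1 = {a, b, c}" "distinct [a, b, c]"
    "vandermonde3 a b c \<noteq> 0" "vandermonde3 a b c \<in> \<rat>"
proof -
  have z: "0 \<in> level 0" by (simp add: level_0)
  obtain a b c where d: "a \<noteq> b" "b \<noteq> c" "a \<noteq> c" and f: "{x. phi x = 0} = {a, b, c}"
    and v: "a + b + c = -7" "a * b + b * c + c * a = 0" "a * b * c = 0 + 7" using level_fibre[OF z] .
  have "vandermonde3 a b c ^ 2 = 91 ^ 2" using phi_discriminant[OF v] by (simp add: vandermonde3_def)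
  then have "vandermonde3 a b c = 91 \<or> vandermonde3 a b c = -91" by (simp only: power2_eq_iff)
  then show ?thesis using that[of a b c] d f level_1_fibre by auto
qed

text \<open>Evenness enters on level 1 only; from there on \<open>galois_approx_step\<close> lifts
  an approximation from each level to the next.\<close>

theorem even_level_maps_galois:
  assumes t: "level_maps t" and abc: "level 1 = {a, b, c}" "distinct [a, b, c]"
    and v: "vandermonde3 a b c \<noteq> 0" "vandermonde3 a b c \<in> \<rat>"
    and even: "vandermonde3 (t 1 a) (t 1 b) (t 1 c) = vandermonde3 a b c"
  shows "\<exists>s\<in>abs_galois. \<forall>n. \<forall>x\<in>level n. s x = t n x"
proof (rule galois_image_closed[OF t])
  have L: "a \<in> level 1" "b \<in> level 1" "c \<in> level 1" using abc by auto
  have Q: "a \<in> Qbar" "b \<in> Qbar" "c \<in> Qbar" using L level_Qbar by blast+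
  have vs: "vandermonde3 (s a) (s b) (s c) = vandermonde3 a b c" if s: "s \<in> abs_galois" for s
  proof -
    have "vandermonde3 (s a) (s b) (s c) = s (vandermonde3 a b c)"
      by (simp add: vandermonde3_def galois_mult[OF s] galois_diff[OF s] Q Qbar_mult Qbar_diff)
    then show ?thesis using galois_maps_rat[OF s v(2)] by simp
  qed
  have tb: "bij_betw (t 1) {a, b, c} {a, b, c}" using t abc unfolding level_maps_def by metis
  have l1: "\<exists>s\<in>abs_galois. \<forall>x\<in>level 1. s x = t 1 x"
  proof -
    have "t 1 a \<in> level 1" using level_maps_closed[OF t L(1)] .
    then obtain s where s: "s \<in> abs_galois" "s a = t 1 a" using galois_transitive[OF L(1)] by blast
    have sb: "bij_betw s {a, b, c} {a, b, c}"
      using galois_level_maps[OF s(1)] abc unfolding level_maps_def by metis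
    have eq: "vandermonde3 (s a) (s b) (s c) = vandermonde3 (t 1 a) (t 1 b) (t 1 c)"
      using vs[OF s(1)] even by simp
    \<comment> \<open>Two permutations of three points that agree at \<open>a\<close> agree
      everywhere or differ by exchanging the other two images; parity excludes the exchange.\<close>
    have "(s b = t 1 b \<and> s c = t 1 c) \<or> (s b = t 1 c \<and> s c = t 1 b)"
      using bij_betw_three_cases[OF abc(2) sb] bij_betw_three_cases[OF abc(2) tb] s(2) abc(2) by auto
    moreover have False if sw: "s b = t 1 c" "s c = t 1 b"
    proof -
      have "vandermonde3 (s a) (s b) (s c) = - vandermonde3 (t 1 a) (t 1 b) (t 1 c)"
        unfolding sw s(2) by (rule vandermonde3_perms)
      then show False using eq even v(1) by simp
    qed
    ultimately show ?thesis using s abc(1) by (intro bexI[of _ s]) auto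
  qed
  have ge1: "\<exists>s\<in>abs_galois. \<forall>x\<in>level n. s x = t n x" if "n \<ge> 1" for n
    using that
  proof (induction n rule: dec_induct)
    case (step n)
    then show ?case using galois_approx_step[OF t] by blast
  qed (fact l1)
  fix n
  show "\<exists>s\<in>abs_galois. \<forall>x\<in>level n. s x = t n x"
  proof (cases n)
    case 0
    have "t 0 0 = 0" using level_maps_closed[OF t, of 0 0] by (simp add: level_0)
    then show ?thesis using 0 galois_id by (intro bexI[of _ id]) (auto simp: level_0)
  qed (use ge1 in auto)
qed

theorem theorem1p6:
  shows "subgroup G_Q_phi AutT \<and> card (rcosets\<^bsub>AutT\<^esub> G_Q_phi) = 2"
proof -
  interpret A: group AutT by (rule group_AutT)
  obtain a b c where abc: "level 1 = {a, b, c}" "distinct [a, b, c]"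
    and v: "vandermonde3 a b c \<noteq> 0" "vandermonde3 a b c \<in> \<rat>" by (rule level_1)
  have L: "a \<in> level 1" "b \<in> level 1" "c \<in> level 1" using abc by auto
  \<comment> \<open>The sign of the permutation induced on level 1; \<open>G_Q_phi\<close> turns out
    to be its kernel.\<close>
  define sg where "sg f = vandermonde3 (level_part f 1 a) (level_part f 1 b) (level_part f 1 c) / vandermonde3 a b c"
    for f
  have bij: "bij_betw (level_part f 1) {a, b, c} {a, b, c}" if "f \<in> tree_aut" for f
    using level_maps_level_part[OF that] abc unfolding level_maps_def by metis
  have val: "sg f = 1 \<or> sg f = -1" if "f \<in> carrier AutT" for f
    using vandermonde3_perm[OF abc(2) bij] that v(1) by (auto simp: sg_def carrier_AutT divide_eq_minus_1_iff)
  have hom: "sg (f \<otimes>\<^bsub>AutT\<^esub> g) = sg f * sg g" if "f \<in> carrier AutT" "g \<in> carrier AutT" for f g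
  proof -
    have fg: "f \<in> tree_aut" "g \<in> tree_aut" using that by (simp_all add: carrier_AutT)
    have "level_part (f \<otimes>\<^bsub>AutT\<^esub> g) 1 x = level_part f 1 (level_part g 1 x)" if x: "x \<in> level 1" for x
    proof -
      have "(f \<otimes>\<^bsub>AutT\<^esub> g) (1, x) = f (g (1, x))"
        unfolding mult_AutT[OF fg] using x by (simp add: compose_def tree_verts_level)
      then show ?thesis using tree_aut_apply[OF fg(2) x] by (simp add: level_part_def)
    qed
    then show ?thesis
      using vandermonde3_comp[OF abc(2) bij[OF fg(2)], of "level_part f 1"] v(1) L
      by (simp add: sg_def field_simps)
  qed
  define w where "w = tree_map (branch_swap a b)"
  have w: "w \<in> tree_aut"
    unfolding w_def by (rule tree_map_in_tree_aut[OF level_maps_branch_swap[OF L(1,2)]])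
  have lw: "level_part w 1 x = (if x = a then b else if x = b then a else x)" if "x \<in> level 1" for x
    unfolding w_def level_part_def tree_map_apply[OF that] by simp
  have "level_part w 1 a = b" "level_part w 1 b = a" "level_part w 1 c = c"
    using lw[OF L(1)] lw[OF L(2)] lw[OF L(3)] abc(2) by auto
  then have "sg w = vandermonde3 b a c / vandermonde3 a b c" by (simp add: sg_def)
  also have "vandermonde3 b a c = - vandermonde3 a b c" by (rule vandermonde3_perms)
  finally have sgw: "sg w = -1" using v(1) by simp
  have "G_Q_phi = {f \<in> carrier AutT. sg f = 1}"
  proof (intro equalityI subsetI)
    fix f assume "f \<in> G_Q_phi"
    then obtain s where s: "s \<in> abs_galois" "f = tree_map (\<lambda>_. s)" by (auto simp: G_Q_phi_def galois_action_eq)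
    have f: "f \<in> tree_aut" unfolding s(2) by (rule tree_map_in_tree_aut[OF galois_level_maps[OF s(1)]])
    have "level_part f 1 x = s x" if "x \<in> level 1" for x
      unfolding s(2) level_part_def tree_map_apply[OF that] by simp
    then have "vandermonde3 (level_part f 1 a) (level_part f 1 b) (level_part f 1 c) = vandermonde3 (s a) (s b) (s c)"
      using L by simp
    also have "\<dots> = s (vandermonde3 a b c)"
      using L level_Qbar by (simp add: vandermonde3_def galois_mult[OF s(1)] galois_diff[OF s(1)] Qbar_mult Qbar_diff)
    also have "\<dots> = vandermonde3 a b c" by (rule galois_maps_rat[OF s(1) v(2)])
    finally show "f \<in> {f \<in> carrier AutT. sg f = 1}" using f v(1) by (simp add: sg_def carrier_AutT)
  next
    fix f assume "f \<in> {f \<in> carrier AutT. sg f = 1}"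
    then have f: "f \<in> tree_aut" and sgf: "sg f = 1" by (simp_all add: carrier_AutT)
    have "vandermonde3 (level_part f 1 a) (level_part f 1 b) (level_part f 1 c) = vandermonde3 a b c"
      using sgf v(1) by (simp add: sg_def)
    from even_level_maps_galois[OF level_maps_level_part[OF f] abc v this]
    obtain s where s: "s \<in> abs_galois" "\<And>n x. x \<in> level n \<Longrightarrow> s x = level_part f n x" by blast
    have "f = tree_map (\<lambda>_. s)"
      using tree_aut_eq_tree_map[OF f] tree_map_cong[of "level_part f" "\<lambda>_. s"] s(2) by metis
    then show "f \<in> G_Q_phi" using s(1) by (auto simp: G_Q_phi_def galois_action_eq)
  qed
  then show ?thesis
    using A.index_2_kernel[of sg w, OF hom val] w sgw by (simp add: carrier_AutT)
qed

end
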